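(* Assume the setting described in the context, and assume moreover that cotupling $[-,-]$ in $\mathcal{K}l(T)$ is monotonic in both arguments and that each zero morphism $0_{X,Y}:X\multimap Y$ is the least element of the poset $Hom_{\mathcal{K}l(T)}(X,Y)$. Then for every $\alpha:X\multimap\overline{F_\tau}X$, every bisimulation on the $TF_\tau$-coalgebra $\alpha^{\bigstar}:X\to TF_\tau X$ is a bisimulation on the $TF^*$-coalgebra $\underline{\alpha}^{\divideontimes}:X\to TF^*X$.
   Context: Let $\mathsf{C}$ be a category with binary coproducts and $(T,\mu,\eta)$ a monad on $\mathsf{C}$. In the Kleisli category $\mathcal{K}l(T)$ (objects of $\mathsf{C}$; morphisms $X\multimap Y$ are $\mathsf{C}$-morphisms $X\to TY$; composition $g\cdot f=\mu_Z\circ Tg\circ f$; identity $1_X=\eta_X$) write $f^\sharp=\eta_Y\circ f$ for $f:X\to Y$ in $\mathsf{C}$; coproducts of $\mathcal{K}l(T)$ are those of $\mathsf{C}$, with coprojections $\iota^1,\iota^2$ and cotupling $[-,-]$. $\mathcal{K}l(T)$ is order-enriched (hom-sets are posets, composition monotone) and $T$ is an order saturation monad: for every $\alpha:X\multimap X$ there is $\alpha^{*}:X\multimap X$ with (a) $1\le\alpha^*$, (b) $\alpha\le\alpha^*$, (c) $\alpha^*\cdot\alpha^*\le\alpha^*$, (d) if $\beta:X\multimap X$ satisfies $1\le\beta$, $\alpha\le\beta$, $\beta\cdot\beta\le\beta$ then $\alpha^*\le\beta$, (e) for all $f:X\to Y$ in $\mathsf{C}$, $\beta:Y\multimap Y$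 and $\Box\in\{\le,\ge\}$: $f^\sharp\cdot\alpha\mathrel{\Box}\beta\cdot f^\sharp$ implies $f^\sharp\cdot\alpha^*\mathrel{\Box}\beta^*\cdot f^\sharp$. A functor $S$ on $\mathsf{C}$ lifts to $\overline{S}$ on $\mathcal{K}l(T)$ if $\overline{S}X=SX$ and $\overline{S}(f^\sharp)=(Sf)^\sharp$; if $(\overline{S},m,e)$ is a monad on $\mathcal{K}l(T)$ then $TS$ is a monad on $\mathsf{C}$ whose Kleisli category is $\mathcal{K}l(\overline{S})$, with hom-sets $Hom_{\mathcal{K}l(T)}(X,\overline{S}Y)$ ordered as in $\mathcal{K}l(T)$. Standing assumptions: $\mathcal{K}l(T)$ has zero morphisms $0_{X,Y}$ (with $f\cdot 0=0=0\cdot g$). $F:\mathsf{C}\to\mathsf{C}$ lifts to $\overline{F}$, so $F_\tau=F+\mathcal{I}d$ lifts to $\overline{F_\tau}=\overline{F}+\mathcal{I}d$, which is a monad $(\overline{F_\tau},m',e')$ on $\mathcal{K}l(T)$ with $e'_X=\iota^2:X\multimap\overline{F}X+X$ and $m'_X=[\iota^1,id]\cdot(\overline{F}([0,id])+id):\overline{F}(\overline{F}X+X)+(\overline{F}X+X)\multimap\overline{F}X+X$. $F$ admits all free $F$-algebras, giving the free monad $F^*$ on $\mathsf{C}$; it lifts to $\overline{F}^*$ on $\mathcal{K}l(T)$ and $(\overline{F}^*,m,e)$ is the free monad over $\overline{F}$ in $\mathcal{K}l(T)$ with universal natural transformation $\nu:\overline{F}\Rightarrow\overline{F}^*$. For both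 $(\overline{S},m,e)=(\overline{F_\tau},m',e')$ and $(\overline{S},m,e)=(\overline{F}^*,m,e)$, $\overline{S}$ is locally monotonic and $m_X\cdot\overline{S}[(m_X\cdot\overline{S}\alpha)^*\cdot e_X]=(m_X\cdot\overline{S}\alpha)^*$ for all $\alpha:X\multimap\overline{S}X$. For $\alpha:X\multimap\overline{F_\tau}X$ put $\alpha^{\bigstar}=(m'_X\cdot\overline{F_\tau}\alpha)^*\cdot e'_X$, and for $\beta:Y\multimap\overline{F}^*Y$ put $\beta^{\divideontimes}=(m_Y\cdot\overline{F}^*\beta)^*\cdot e_Y$ (these are saturation operators making $TF_\tau$ and $TF^*$ order saturation monads). For $\alpha:X\multimap\overline{F_\tau}X$ let $\underline{\alpha}=[\nu_X,e_X]\cdot\alpha:X\multimap\overline{F}^*X$. Bisimulation (kernel bisimulation): for an endofunctor $G$ on $\mathsf{C}$ and $G$-coalgebras $\alpha:X\to GX$, $\beta:Y\to GY$, a jointly monic span $X\xleftarrow{\pi_1}R\xrightarrow{\pi_2}Y$ is a bisimulation if there exist a $G$-coalgebra $\gamma:Z\to GZ$ and coalgebra homomorphisms $f$ from $\alpha$ to $\gamma$ and $g$ from $\beta$ to $\gamma$ (i.e. $Gf\circ\alpha=\gamma\circ f$, $Gg\circ\beta=\gamma\circ g$) such that $(R,\pi_1,\pi_2)$ is the pullback of $X\xrightarrow{f}Z\xleftarrow{g}Y$. A bisimulation on a coalgebra is a bisimulation between it and itself. *)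

theory Defs
  imports Main
begin

text \<open>
  The objects of a category are all elements of the type \<open>'o\<close>. Hom-sets need not be disjoint (in a
  Kleisli category an arrow does not determine its codomain), so composition and the action of
  functors on arrows are indexed by objects: \<open>cmp C X Y Z g f\<close> is the composite
  of \<open>f : X \<rightarrow> Y\<close> with \<open>g : Y \<rightarrow> Z\<close>.
\<close>

record ('o, 'a) cat =
  hom :: "'o \<Rightarrow> 'o \<Rightarrow> 'a set"
  cmp :: "'o \<Rightarrow> 'o \<Rightarrow> 'o \<Rightarrow> 'a \<Rightarrow> 'a \<Rightarrow> 'a"
  idm :: "'o \<Rightarrow> 'a"

definition is_category :: "('o, 'a) cat \<Rightarrow> bool" where
  "is_category C \<longleftrightarrow>
     (\<forall>X. idm C X \<in> hom C X X) \<and>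
     (\<forall>X Y Z. \<forall>f \<in> hom C X Y. \<forall>g \<in> hom C Y Z. cmp C X Y Z g f \<in> hom C X Z) \<and>
     (\<forall>X Y. \<forall>f \<in> hom C X Y. cmp C X X Y f (idm C X) = f \<and> cmp C X Y Y (idm C Y) f = f) \<and>
     (\<forall>W X Y Z. \<forall>f \<in> hom C W X. \<forall>g \<in> hom C X Y. \<forall>h \<in> hom C Y Z.
        cmp C W X Z (cmp C X Y Z h g) f = cmp C W Y Z h (cmp C W X Y g f))"

record ('o, 'a) endofunctor =
  ob :: "'o \<Rightarrow> 'o"
  ar :: "'o \<Rightarrow> 'o \<Rightarrow> 'a \<Rightarrow> 'a"

record ('o, 'a) monad = "('o, 'a) endofunctor" +
  mult :: "'o \<Rightarrow> 'a"
  unit :: "'o \<Rightarrow> 'a"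

definition is_functor :: "('o, 'a) cat \<Rightarrow> ('o, 'a, 'm) endofunctor_scheme \<Rightarrow> bool" where
  "is_functor C F \<longleftrightarrow>
     (\<forall>X Y. \<forall>f \<in> hom C X Y. ar F X Y f \<in> hom C (ob F X) (ob F Y)) \<and>
     (\<forall>X. ar F X X (idm C X) = idm C (ob F X)) \<and>
     (\<forall>X Y Z. \<forall>f \<in> hom C X Y. \<forall>g \<in> hom C Y Z.
        ar F X Z (cmp C X Y Z g f) =
        cmp C (ob F X) (ob F Y) (ob F Z) (ar F Y Z g) (ar F X Y f))"

definition id_functor :: "('o, 'a) endofunctor" where
  "id_functor = \<lparr>ob = (\<lambda>X. X), ar = (\<lambda>X Y f. f)\<rparr>"

definition comp_functor ::
  "('o, 'a, 'm) endofunctor_scheme \<Rightarrow> ('o, 'a, 'n) endofunctor_scheme \<Rightarrow> ('o, 'a) endofunctor" where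
  "comp_functor G F =
     \<lparr>ob = (\<lambda>X. ob G (ob F X)), ar = (\<lambda>X Y f. ar G (ob F X) (ob F Y) (ar F X Y f))\<rparr>"

definition is_nat_trans ::
  "('o, 'a) cat \<Rightarrow> ('o, 'a, 'm) endofunctor_scheme \<Rightarrow> ('o, 'a, 'n) endofunctor_scheme
     \<Rightarrow> ('o \<Rightarrow> 'a) \<Rightarrow> bool" where
  "is_nat_trans C F G t \<longleftrightarrow>
     (\<forall>X. t X \<in> hom C (ob F X) (ob G X)) \<and>
     (\<forall>X Y. \<forall>f \<in> hom C X Y.
        cmp C (ob F X) (ob F Y) (ob G Y) (t Y) (ar F X Y f) =
        cmp C (ob F X) (ob G X) (ob G Y) (ar G X Y f) (t X))"

definition is_monad :: "('o, 'a) cat \<Rightarrow> ('o, 'a) monad \<Rightarrow> bool" where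
  "is_monad C S \<longleftrightarrow>
     is_functor C S \<and>
     is_nat_trans C id_functor S (unit S) \<and>
     is_nat_trans C (comp_functor S S) S (mult S) \<and>
     (\<forall>X. let SX = ob S X; SSX = ob S SX; SSSX = ob S SSX in
        cmp C SX SSX SX (mult S X) (unit S SX) = idm C SX \<and>
        cmp C SX SSX SX (mult S X) (ar S X SX (unit S X)) = idm C SX \<and>
        cmp C SSSX SSX SX (mult S X) (mult S SX) =
        cmp C SSSX SSX SX (mult S X) (ar S SSX SX (mult S X)))"

definition is_monad_morphism ::
  "('o, 'a) cat \<Rightarrow> ('o, 'a) monad \<Rightarrow> ('o, 'a) monad \<Rightarrow> ('o \<Rightarrow> 'a) \<Rightarrow> bool" where
  "is_monad_morphism C S S' h \<longleftrightarrow>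
     is_nat_trans C S S' h \<and>
     (\<forall>X. cmp C X (ob S X) (ob S' X) (h X) (unit S X) = unit S' X) \<and>
     (\<forall>X. let SX = ob S X; SSX = ob S SX; S'X = ob S' X; S'SX = ob S' SX; S'S'X = ob S' S'X in
        cmp C SSX SX S'X (h X) (mult S X) =
        cmp C SSX S'S'X S'X (mult S' X) (cmp C SSX S'SX S'S'X (ar S' SX S'X (h X)) (h SX)))"

definition is_free_monad_over ::
  "('o, 'a) cat \<Rightarrow> ('o, 'a) endofunctor \<Rightarrow> ('o, 'a) monad \<Rightarrow> ('o \<Rightarrow> 'a) \<Rightarrow> bool" where
  "is_free_monad_over C F S \<nu> \<longleftrightarrow>
     is_monad C S \<and> is_nat_trans C F S \<nu> \<and>
     (\<forall>S' s. is_monad C S' \<and> is_nat_trans C F S' s \<longrightarrow>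
        (\<exists>!h. is_monad_morphism C S S' h \<and>
              (\<forall>X. cmp C (ob F X) (ob S X) (ob S' X) (h X) (\<nu> X) = s X)))"

definition is_alg_ext ::
  "('o, 'a) cat \<Rightarrow> ('o, 'a) endofunctor \<Rightarrow> 'o \<Rightarrow> 'o \<Rightarrow> 'a \<Rightarrow> 'a \<Rightarrow> 'o \<Rightarrow> 'a \<Rightarrow> 'a \<Rightarrow> 'a \<Rightarrow> bool" where
  "is_alg_ext C F X A \<phi> u B b f h \<longleftrightarrow>
     h \<in> hom C A B \<and>
     cmp C (ob F A) A B h \<phi> = cmp C (ob F A) (ob F B) B b (ar F A B h) \<and>
     cmp C X A B h u = f"

definition is_free_algebra ::
  "('o, 'a) cat \<Rightarrow> ('o, 'a) endofunctor \<Rightarrow> 'o \<Rightarrow> 'o \<Rightarrow> 'a \<Rightarrow> 'a \<Rightarrow> bool" where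
  "is_free_algebra C F X A \<phi> u \<longleftrightarrow>
     \<phi> \<in> hom C (ob F A) A \<and> u \<in> hom C X A \<and>
     (\<forall>B. \<forall>b \<in> hom C (ob F B) B. \<forall>f \<in> hom C X B. \<exists>!h. is_alg_ext C F X A \<phi> u B b f h)"

definition free_algebra_monad ::
  "('o, 'a) cat \<Rightarrow> ('o, 'a) endofunctor \<Rightarrow> ('o \<Rightarrow> 'o) \<Rightarrow> ('o \<Rightarrow> 'a) \<Rightarrow> ('o \<Rightarrow> 'a) \<Rightarrow> ('o, 'a) monad" where
  "free_algebra_monad C F A \<phi> u =
     \<lparr>ob = A,
      ar = (\<lambda>X Y f. THE h. is_alg_ext C F X (A X) (\<phi> X) (u X)
                             (A Y) (\<phi> Y) (cmp C X Y (A Y) (u Y) f) h),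
      mult = (\<lambda>X. THE h. is_alg_ext C F (A X) (A (A X)) (\<phi> (A X)) (u (A X))
                             (A X) (\<phi> X) (idm C (A X)) h),
      unit = u\<rparr>"

record ('o, 'a) coprods =
  sum_ob :: "'o \<Rightarrow> 'o \<Rightarrow> 'o"
  inj1 :: "'o \<Rightarrow> 'o \<Rightarrow> 'a"
  inj2 :: "'o \<Rightarrow> 'o \<Rightarrow> 'a"

definition is_cotuple ::
  "('o, 'a) cat \<Rightarrow> ('o, 'a) coprods \<Rightarrow> 'o \<Rightarrow> 'o \<Rightarrow> 'o \<Rightarrow> 'a \<Rightarrow> 'a \<Rightarrow> 'a \<Rightarrow> bool" where
  "is_cotuple C P X Y Z f g h \<longleftrightarrow>
     h \<in> hom C (sum_ob P X Y) Z \<and>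
     cmp C X (sum_ob P X Y) Z h (inj1 P X Y) = f \<and>
     cmp C Y (sum_ob P X Y) Z h (inj2 P X Y) = g"

definition has_coproducts :: "('o, 'a) cat \<Rightarrow> ('o, 'a) coprods \<Rightarrow> bool" where
  "has_coproducts C P \<longleftrightarrow>
     (\<forall>X Y. inj1 P X Y \<in> hom C X (sum_ob P X Y) \<and>
            inj2 P X Y \<in> hom C Y (sum_ob P X Y) \<and>
            (\<forall>Z. \<forall>f \<in> hom C X Z. \<forall>g \<in> hom C Y Z. \<exists>!h. is_cotuple C P X Y Z f g h))"

definition cotuple ::
  "('o, 'a) cat \<Rightarrow> ('o, 'a) coprods \<Rightarrow> 'o \<Rightarrow> 'o \<Rightarrow> 'o \<Rightarrow> 'a \<Rightarrow> 'a \<Rightarrow> 'a" where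
  "cotuple C P X Y Z f g = (THE h. is_cotuple C P X Y Z f g h)"

definition sum_map ::
  "('o, 'a) cat \<Rightarrow> ('o, 'a) coprods \<Rightarrow> 'o \<Rightarrow> 'o \<Rightarrow> 'o \<Rightarrow> 'o \<Rightarrow> 'a \<Rightarrow> 'a \<Rightarrow> 'a" where
  "sum_map C P X Y X' Y' f g =
     cotuple C P X Y (sum_ob P X' Y')
       (cmp C X X' (sum_ob P X' Y') (inj1 P X' Y') f)
       (cmp C Y Y' (sum_ob P X' Y') (inj2 P X' Y') g)"

definition plus_id ::
  "('o, 'a) cat \<Rightarrow> ('o, 'a) coprods \<Rightarrow> ('o, 'a) endofunctor \<Rightarrow> ('o, 'a) endofunctor" where
  "plus_id C P F =
     \<lparr>ob = (\<lambda>X. sum_ob P (ob F X) X),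
      ar = (\<lambda>X Y f. sum_map C P (ob F X) X (ob F Y) Y (ar F X Y f) f)\<rparr>"

definition Kl :: "('o, 'a) cat \<Rightarrow> ('o, 'a) monad \<Rightarrow> ('o, 'a) cat" where
  "Kl C T =
     \<lparr>hom = (\<lambda>X Y. hom C X (ob T Y)),
      cmp = (\<lambda>X Y Z g f.
               cmp C X (ob T (ob T Z)) (ob T Z) (mult T Z)
                 (cmp C X (ob T Y) (ob T (ob T Z)) (ar T Y (ob T Z) g) f)),
      idm = unit T\<rparr>"

definition sharp :: "('o, 'a) cat \<Rightarrow> ('o, 'a) monad \<Rightarrow> 'o \<Rightarrow> 'o \<Rightarrow> 'a \<Rightarrow> 'a" where
  "sharp C T X Y f = cmp C X Y (ob T Y) (unit T Y) f"

definition Kl_coprods :: "('o, 'a) cat \<Rightarrow> ('o, 'a) monad \<Rightarrow> ('o, 'a) coprods \<Rightarrow> ('o, 'a) coprods" where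
  "Kl_coprods C T P =
     \<lparr>sum_ob = sum_ob P,
      inj1 = (\<lambda>X Y. sharp C T X (sum_ob P X Y) (inj1 P X Y)),
      inj2 = (\<lambda>X Y. sharp C T Y (sum_ob P X Y) (inj2 P X Y))\<rparr>"

definition lifts_to ::
  "('o, 'a) cat \<Rightarrow> ('o, 'a) monad \<Rightarrow> ('o, 'a, 'm) endofunctor_scheme
     \<Rightarrow> ('o, 'a, 'n) endofunctor_scheme \<Rightarrow> bool" where
  "lifts_to C T S S' \<longleftrightarrow>
     is_functor C S \<and> is_functor (Kl C T) S' \<and>
     (\<forall>X. ob S' X = ob S X) \<and>
     (\<forall>X Y. \<forall>f \<in> hom C X Y.
        ar S' X Y (sharp C T X Y f) = sharp C T (ob S X) (ob S Y) (ar S X Y f))"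

type_synonym ('o, 'a) hom_order = "'o \<Rightarrow> 'o \<Rightarrow> 'a \<Rightarrow> 'a \<Rightarrow> bool"

definition order_enriched :: "('o, 'a) cat \<Rightarrow> ('o, 'a) hom_order \<Rightarrow> bool" where
  "order_enriched K le \<longleftrightarrow>
     (\<forall>X Y. reflp_on (hom K X Y) (le X Y) \<and> transp_on (hom K X Y) (le X Y) \<and>
            antisymp_on (hom K X Y) (le X Y)) \<and>
     (\<forall>X Y Z. \<forall>f \<in> hom K X Y. \<forall>f' \<in> hom K X Y. \<forall>g \<in> hom K Y Z. \<forall>g' \<in> hom K Y Z.
        le X Y f f' \<and> le Y Z g g' \<longrightarrow> le X Z (cmp K X Y Z g f) (cmp K X Y Z g' f'))"

definition order_saturation ::
  "('o, 'a) cat \<Rightarrow> ('o, 'a) monad \<Rightarrow> ('o, 'a) hom_order \<Rightarrow> ('o \<Rightarrow> 'a \<Rightarrow> 'a) \<Rightarrow> bool" where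
  "order_saturation C T le star \<longleftrightarrow>
     (let K = Kl C T in
      (\<forall>X. \<forall>\<alpha> \<in> hom K X X.
         star X \<alpha> \<in> hom K X X \<and>
         le X X (idm K X) (star X \<alpha>) \<and>
         le X X \<alpha> (star X \<alpha>) \<and>
         le X X (cmp K X X X (star X \<alpha>) (star X \<alpha>)) (star X \<alpha>) \<and>
         (\<forall>\<beta> \<in> hom K X X.
            le X X (idm K X) \<beta> \<and> le X X \<alpha> \<beta> \<and> le X X (cmp K X X X \<beta> \<beta>) \<beta> \<longrightarrow> le X X (star X \<alpha>) \<beta>)) \<and>
      (\<forall>X Y. \<forall>\<alpha> \<in> hom K X X. \<forall>\<beta> \<in> hom K Y Y. \<forall>f \<in> hom C X Y.
         let f' = sharp C T X Y f in
         (le X Y (cmp K X X Y f' \<alpha>) (cmp K X Y Y \<beta> f') \<longrightarrow>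
          le X Y (cmp K X X Y f' (star X \<alpha>)) (cmp K X Y Y (star Y \<beta>) f')) \<and>
         (le X Y (cmp K X Y Y \<beta> f') (cmp K X X Y f' \<alpha>) \<longrightarrow>
          le X Y (cmp K X Y Y (star Y \<beta>) f') (cmp K X X Y f' (star X \<alpha>)))))"

definition locally_monotonic ::
  "('o, 'a) cat \<Rightarrow> ('o, 'a) hom_order \<Rightarrow> ('o, 'a, 'm) endofunctor_scheme \<Rightarrow> bool" where
  "locally_monotonic K le S \<longleftrightarrow>
     (\<forall>X Y. \<forall>f \<in> hom K X Y. \<forall>g \<in> hom K X Y.
        le X Y f g \<longrightarrow> le (ob S X) (ob S Y) (ar S X Y f) (ar S X Y g))"

definition kl_ext :: "('o, 'a) cat \<Rightarrow> ('o, 'a) monad \<Rightarrow> 'o \<Rightarrow> 'o \<Rightarrow> 'a \<Rightarrow> 'a" where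
  "kl_ext K S X Y \<alpha> = cmp K (ob S X) (ob S (ob S Y)) (ob S Y) (mult S Y) (ar S X (ob S Y) \<alpha>)"

definition saturate ::
  "('o, 'a) cat \<Rightarrow> ('o \<Rightarrow> 'a \<Rightarrow> 'a) \<Rightarrow> ('o, 'a) monad \<Rightarrow> 'o \<Rightarrow> 'a \<Rightarrow> 'a" where
  "saturate K star S X \<alpha> = cmp K X (ob S X) (ob S X) (star (ob S X) (kl_ext K S X X \<alpha>)) (unit S X)"

definition saturation_condition ::
  "('o, 'a) cat \<Rightarrow> ('o \<Rightarrow> 'a \<Rightarrow> 'a) \<Rightarrow> ('o, 'a) monad \<Rightarrow> bool" where
  "saturation_condition K star S \<longleftrightarrow>
     (\<forall>X. \<forall>\<alpha> \<in> hom K X (ob S X).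
        kl_ext K S X X (saturate K star S X \<alpha>) = star (ob S X) (kl_ext K S X X \<alpha>))"

definition cotupling_monotonic ::
  "('o, 'a) cat \<Rightarrow> ('o, 'a) coprods \<Rightarrow> ('o, 'a) hom_order \<Rightarrow> bool" where
  "cotupling_monotonic K P le \<longleftrightarrow>
     (\<forall>X Y Z. \<forall>f \<in> hom K X Z. \<forall>f' \<in> hom K X Z. \<forall>g \<in> hom K Y Z. \<forall>g' \<in> hom K Y Z.
        le X Z f f' \<and> le Y Z g g' \<longrightarrow>
        le (sum_ob P X Y) Z (cotuple K P X Y Z f g) (cotuple K P X Y Z f' g'))"

definition zero_morphisms :: "('o, 'a) cat \<Rightarrow> ('o \<Rightarrow> 'o \<Rightarrow> 'a) \<Rightarrow> bool" where
  "zero_morphisms K zero \<longleftrightarrow>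
     (\<forall>X Y. zero X Y \<in> hom K X Y) \<and>
     (\<forall>X Y Z. \<forall>f \<in> hom K Y Z. cmp K X Y Z f (zero X Y) = zero X Z) \<and>
     (\<forall>X Y Z. \<forall>g \<in> hom K X Y. cmp K X Y Z (zero Y Z) g = zero X Z)"

definition tau_monad ::
  "('o, 'a) cat \<Rightarrow> ('o, 'a) coprods \<Rightarrow> ('o \<Rightarrow> 'o \<Rightarrow> 'a) \<Rightarrow> ('o, 'a) endofunctor \<Rightarrow> ('o, 'a) monad" where
  "tau_monad K P zero F =
     \<lparr>ob = ob (plus_id K P F),
      ar = ar (plus_id K P F),
      mult = (\<lambda>X.
        let FX = ob F X; G = sum_ob P FX X; FG = ob F G in
        cmp K (sum_ob P FG G) (sum_ob P FX G) G
          (cotuple K P FX G G (inj1 P FX X) (idm K G))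
          (sum_map K P FG G FX G
             (ar F G X (cotuple K P FX X X (zero FX X) (idm K X))) (idm K G))),
      unit = (\<lambda>X. inj2 P (ob F X) X)\<rparr>"

definition underline ::
  "('o, 'a) cat \<Rightarrow> ('o, 'a) coprods \<Rightarrow> ('o, 'a) endofunctor \<Rightarrow> ('o, 'a) monad \<Rightarrow> ('o \<Rightarrow> 'a)
     \<Rightarrow> 'o \<Rightarrow> 'a \<Rightarrow> 'a" where
  "underline K P F S \<nu> X \<alpha> =
     cmp K X (sum_ob P (ob F X) X) (ob S X)
       (cotuple K P (ob F X) X (ob S X) (\<nu> X) (unit S X)) \<alpha>"

definition jointly_monic :: "('o, 'a) cat \<Rightarrow> 'o \<Rightarrow> 'o \<Rightarrow> 'o \<Rightarrow> 'a \<Rightarrow> 'a \<Rightarrow> bool" where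
  "jointly_monic C R X Y p q \<longleftrightarrow>
     p \<in> hom C R X \<and> q \<in> hom C R Y \<and>
     (\<forall>W. \<forall>u \<in> hom C W R. \<forall>v \<in> hom C W R.
        cmp C W R X p u = cmp C W R X p v \<and> cmp C W R Y q u = cmp C W R Y q v \<longrightarrow> u = v)"

definition is_pullback ::
  "('o, 'a) cat \<Rightarrow> 'o \<Rightarrow> 'o \<Rightarrow> 'o \<Rightarrow> 'a \<Rightarrow> 'a \<Rightarrow> 'o \<Rightarrow> 'a \<Rightarrow> 'a \<Rightarrow> bool" where
  "is_pullback C X Y Z f g R p q \<longleftrightarrow>
     p \<in> hom C R X \<and> q \<in> hom C R Y \<and> cmp C R X Z f p = cmp C R Y Z g q \<and>
     (\<forall>W. \<forall>u \<in> hom C W X. \<forall>v \<in> hom C W Y. cmp C W X Z f u = cmp C W Y Z g v \<longrightarrow>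
        (\<exists>!h. h \<in> hom C W R \<and> cmp C W R X p h = u \<and> cmp C W R Y q h = v))"

definition is_coalg_hom ::
  "('o, 'a) cat \<Rightarrow> ('o, 'a) endofunctor \<Rightarrow> 'o \<Rightarrow> 'a \<Rightarrow> 'o \<Rightarrow> 'a \<Rightarrow> 'a \<Rightarrow> bool" where
  "is_coalg_hom C G X \<alpha> Z \<gamma> f \<longleftrightarrow>
     f \<in> hom C X Z \<and>
     cmp C X (ob G X) (ob G Z) (ar G X Z f) \<alpha> = cmp C X Z (ob G Z) \<gamma> f"

definition is_bisimulation ::
  "('o, 'a) cat \<Rightarrow> ('o, 'a) endofunctor \<Rightarrow> 'o \<Rightarrow> 'a \<Rightarrow> 'o \<Rightarrow> 'a \<Rightarrow> 'o \<Rightarrow> 'a \<Rightarrow> 'a \<Rightarrow> bool" where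
  "is_bisimulation C G X \<alpha> Y \<beta> R p q \<longleftrightarrow>
     jointly_monic C R X Y p q \<and>
     (\<exists>Z f g. \<exists>\<gamma> \<in> hom C Z (ob G Z).
        is_coalg_hom C G X \<alpha> Z \<gamma> f \<and> is_coalg_hom C G Y \<beta> Z \<gamma> g \<and>
        is_pullback C X Y Z f g R p q)"

end

theory Submission
  imports Defs
begin

text \<open>
  Write \<open>h\<close> for the natural transformation \<open>[\<nu>, e]\<close> from \<open>F\<^sub>\<tau>\<close> to the free monad. Minimality of zero
  makes it a lax monad morphism, which gives \<open>h \<cdot> (m' \<cdot> F\<^sub>\<tau> \<alpha>) \<le> (m \<cdot> F\<^sup>*(h \<cdot> \<alpha>)) \<cdot> h\<close>. Once this is
  known to survive saturation of both endomorphisms, \<open>h \<cdot> \<alpha>\<close> and \<open>h \<cdot> \<beta>\<close> have the same saturation,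
  where \<open>\<beta>\<close> is the saturation of \<open>\<alpha>\<close>. Hence a coalgebra homomorphism from \<open>\<beta>\<close> to \<open>\<gamma>\<close> is also one
  from the saturation of \<open>h \<cdot> \<alpha>\<close> to that of \<open>h \<cdot> \<gamma>\<close>, and the same pullback witnesses the bisimulation.

  The saturation axiom for inequations only speaks about arrows coming from the base category,
  and \<open>h\<close> need not be one. But the free algebras of the base category remain free in the Kleisli
  category and thus yield a second free monad, whose \<open>h\<close> does come from the base category. By
  uniqueness of free monads the given \<open>h\<close> differs from that one by an isomorphism, and saturation
  commutes with conjugation by isomorphisms.
\<close>

section \<open>Categories, functors and monads\<close>

lemma id_hom [simp]: "is_category C \<Longrightarrow> idm C X \<in> hom C X X"
  unfolding is_category_def by blast

lemma comp_hom [simp]: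
  "is_category C \<Longrightarrow> f \<in> hom C X Y \<Longrightarrow> g \<in> hom C Y Z \<Longrightarrow> cmp C X Y Z g f \<in> hom C X Z"
  unfolding is_category_def by blast

lemma comp_id_right [simp]: "is_category C \<Longrightarrow> f \<in> hom C X Y \<Longrightarrow> cmp C X X Y f (idm C X) = f"
  unfolding is_category_def by blast

lemma comp_id_left [simp]: "is_category C \<Longrightarrow> f \<in> hom C X Y \<Longrightarrow> cmp C X Y Y (idm C Y) f = f"
  unfolding is_category_def by blast

lemma comp_assoc:
  "is_category C \<Longrightarrow> f \<in> hom C W X \<Longrightarrow> g \<in> hom C X Y \<Longrightarrow> h \<in> hom C Y Z \<Longrightarrow>
   cmp C W X Z (cmp C X Y Z h g) f = cmp C W Y Z h (cmp C W X Y g f)"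
  unfolding is_category_def by blast

text \<open>Composites are normalised by associating to the right, where an equation between two
  binary composites no longer matches once a further arrow precedes it. This rule precomposes such
  an equation with \<open>h\<close>; the two intermediate objects may differ.\<close>

lemma comp_reassoc:
  assumes "is_category C" "cmp C X Y Z g f = cmp C X Y' Z g' f'"
    and "f \<in> hom C X Y" "g \<in> hom C Y Z" "f' \<in> hom C X Y'" "g' \<in> hom C Y' Z" "h \<in> hom C W X"
  shows "cmp C W Y Z g (cmp C W X Y f h) = cmp C W Y' Z g' (cmp C W X Y' f' h)"
  using assms by (metis comp_assoc)

lemma functor_hom [simp]:
  "is_functor C F \<Longrightarrow> f \<in> hom C X Y \<Longrightarrow> ar F X Y f \<in> hom C (ob F X) (ob F Y)"
  unfolding is_functor_def by blast

lemma functor_id [simp]: "is_functor C F \<Longrightarrow> ar F X X (idm C X) = idm C (ob F X)"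
  unfolding is_functor_def by blast

lemma functor_comp:
  "is_functor C F \<Longrightarrow> f \<in> hom C X Y \<Longrightarrow> g \<in> hom C Y Z \<Longrightarrow>
   ar F X Z (cmp C X Y Z g f) = cmp C (ob F X) (ob F Y) (ob F Z) (ar F Y Z g) (ar F X Y f)"
  unfolding is_functor_def by blast

lemma nat_trans_hom: "is_nat_trans C F G t \<Longrightarrow> t X \<in> hom C (ob F X) (ob G X)"
  unfolding is_nat_trans_def by blast

lemma naturality:
  "is_nat_trans C F G t \<Longrightarrow> f \<in> hom C X Y \<Longrightarrow>
   cmp C (ob F X) (ob F Y) (ob G Y) (t Y) (ar F X Y f) =
   cmp C (ob F X) (ob G X) (ob G Y) (ar G X Y f) (t X)"
  unfolding is_nat_trans_def by blast

lemma monad_functor [simp]: "is_monad C S \<Longrightarrow> is_functor C S"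
  unfolding is_monad_def by blast

lemma unit_hom [simp]: "is_monad C S \<Longrightarrow> unit S X \<in> hom C X (ob S X)"
  unfolding is_monad_def is_nat_trans_def id_functor_def by simp

lemma mult_hom [simp]: "is_monad C S \<Longrightarrow> mult S X \<in> hom C (ob S (ob S X)) (ob S X)"
  unfolding is_monad_def is_nat_trans_def comp_functor_def by simp

lemma unit_natural:
  "is_monad C S \<Longrightarrow> f \<in> hom C X Y \<Longrightarrow>
   cmp C X (ob S X) (ob S Y) (ar S X Y f) (unit S X) = cmp C X Y (ob S Y) (unit S Y) f"
  unfolding is_monad_def is_nat_trans_def id_functor_def by simp

lemma mult_natural:
  "is_monad C S \<Longrightarrow> f \<in> hom C X Y \<Longrightarrow>
   cmp C (ob S (ob S X)) (ob S X) (ob S Y) (ar S X Y f) (mult S X) =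
   cmp C (ob S (ob S X)) (ob S (ob S Y)) (ob S Y) (mult S Y) (ar S (ob S X) (ob S Y) (ar S X Y f))"
  unfolding is_monad_def is_nat_trans_def comp_functor_def by simp

lemma mult_unit [simp]:
  "is_monad C S \<Longrightarrow> cmp C (ob S X) (ob S (ob S X)) (ob S X) (mult S X) (unit S (ob S X)) = idm C (ob S X)"
  unfolding is_monad_def Let_def by blast

lemma mult_ar_unit [simp]:
  "is_monad C S \<Longrightarrow>
   cmp C (ob S X) (ob S (ob S X)) (ob S X) (mult S X) (ar S X (ob S X) (unit S X)) = idm C (ob S X)"
  unfolding is_monad_def Let_def by blast

lemma mult_assoc:
  "is_monad C S \<Longrightarrow>
   cmp C (ob S (ob S (ob S X))) (ob S (ob S X)) (ob S X) (mult S X) (mult S (ob S X)) =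
   cmp C (ob S (ob S (ob S X))) (ob S (ob S X)) (ob S X) (mult S X)
     (ar S (ob S (ob S X)) (ob S X) (mult S X))"
  unfolding is_monad_def Let_def by blast

text \<open>The \<open>_comp\<close> variants from here on are the monad and naturality laws in
  precomposed form, ready for rewriting right-associated composites.\<close>

lemma mult_unit_comp [simp]:
  assumes "is_category C" "is_monad C S" "f \<in> hom C W (ob S X)"
  shows "cmp C W (ob S (ob S X)) (ob S X) (mult S X) (cmp C W (ob S X) (ob S (ob S X)) (unit S (ob S X)) f) = f"
  using assms by (simp flip: comp_assoc)

lemma mult_ar_unit_comp [simp]:
  assumes "is_category C" "is_monad C S" "f \<in> hom C W (ob S X)"
  shows "cmp C W (ob S (ob S X)) (ob S X) (mult S X)
    (cmp C W (ob S X) (ob S (ob S X)) (ar S X (ob S X) (unit S X)) f) = f"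
  using assms by (simp flip: comp_assoc)

lemma mult_assoc_comp:
  assumes "is_category C" "is_monad C S" "f \<in> hom C W (ob S (ob S (ob S X)))"
  shows "cmp C W (ob S (ob S X)) (ob S X) (mult S X)
      (cmp C W (ob S (ob S (ob S X))) (ob S (ob S X)) (mult S (ob S X)) f) =
    cmp C W (ob S (ob S X)) (ob S X) (mult S X)
      (cmp C W (ob S (ob S (ob S X))) (ob S (ob S X)) (ar S (ob S (ob S X)) (ob S X) (mult S X)) f)"
  using assms by (intro comp_reassoc mult_assoc) auto

lemma mult_natural_comp:
  assumes "is_category C" "is_monad C S" "f \<in> hom C X Y" "g \<in> hom C W (ob S (ob S X))"
  shows "cmp C W (ob S X) (ob S Y) (ar S X Y f) (cmp C W (ob S (ob S X)) (ob S X) (mult S X) g) =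
    cmp C W (ob S (ob S Y)) (ob S Y) (mult S Y)
      (cmp C W (ob S (ob S X)) (ob S (ob S Y)) (ar S (ob S X) (ob S Y) (ar S X Y f)) g)"
  using assms by (intro comp_reassoc mult_natural) auto

lemma unit_natural_comp:
  assumes "is_category C" "is_monad C S" "f \<in> hom C X Y" "g \<in> hom C W X"
  shows "cmp C W (ob S X) (ob S Y) (ar S X Y f) (cmp C W X (ob S X) (unit S X) g) =
    cmp C W Y (ob S Y) (unit S Y) (cmp C W X Y f g)"
  using assms by (intro comp_reassoc unit_natural) auto

lemma naturality_comp:
  assumes "is_category C" "is_functor C F" "is_functor C G" "is_nat_trans C F G t"
    and "f \<in> hom C X Y" "g \<in> hom C W (ob F X)"
  shows "cmp C W (ob F Y) (ob G Y) (t Y) (cmp C W (ob F X) (ob F Y) (ar F X Y f) g) =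
    cmp C W (ob G X) (ob G Y) (ar G X Y f) (cmp C W (ob F X) (ob G X) (t X) g)"
  using assms by (intro comp_reassoc naturality) (auto intro: nat_trans_hom)


section \<open>Coproducts\<close>

lemma inj1_hom [simp]: "has_coproducts C P \<Longrightarrow> inj1 P X Y \<in> hom C X (sum_ob P X Y)"
  and inj2_hom [simp]: "has_coproducts C P \<Longrightarrow> inj2 P X Y \<in> hom C Y (sum_ob P X Y)"
  by (simp_all add: has_coproducts_def)

lemma is_cotuple_cotuple:
  "has_coproducts C P \<Longrightarrow> f \<in> hom C X Z \<Longrightarrow> g \<in> hom C Y Z \<Longrightarrow>
   is_cotuple C P X Y Z f g (cotuple C P X Y Z f g)"
  unfolding cotuple_def by (rule theI') (unfold has_coproducts_def, blast)

lemma cotuple_hom [simp]: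
  "has_coproducts C P \<Longrightarrow> f \<in> hom C X Z \<Longrightarrow> g \<in> hom C Y Z \<Longrightarrow>
   cotuple C P X Y Z f g \<in> hom C (sum_ob P X Y) Z"
  and cotuple_inj1 [simp]:
  "has_coproducts C P \<Longrightarrow> f \<in> hom C X Z \<Longrightarrow> g \<in> hom C Y Z \<Longrightarrow>
   cmp C X (sum_ob P X Y) Z (cotuple C P X Y Z f g) (inj1 P X Y) = f"
  and cotuple_inj2 [simp]:
  "has_coproducts C P \<Longrightarrow> f \<in> hom C X Z \<Longrightarrow> g \<in> hom C Y Z \<Longrightarrow>
   cmp C Y (sum_ob P X Y) Z (cotuple C P X Y Z f g) (inj2 P X Y) = g"
  using is_cotuple_cotuple[of C P f X Z g Y] by (simp_all add: is_cotuple_def)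

lemma cotuple_unique:
  assumes "has_coproducts C P" "is_cotuple C P X Y Z f g h" "f \<in> hom C X Z" "g \<in> hom C Y Z"
  shows "h = cotuple C P X Y Z f g"
  using assms is_cotuple_cotuple[of C P f X Z g Y] unfolding has_coproducts_def by blast

lemma comp_cotuple:
  assumes "is_category C" "has_coproducts C P" "f \<in> hom C X Z" "g \<in> hom C Y Z" "k \<in> hom C Z W"
  shows "cmp C (sum_ob P X Y) Z W k (cotuple C P X Y Z f g) =
    cotuple C P X Y W (cmp C X Z W k f) (cmp C Y Z W k g)"
  using assms by (intro cotuple_unique) (simp_all add: is_cotuple_def comp_assoc)

lemma sum_map_hom [simp]:
  "is_category C \<Longrightarrow> has_coproducts C P \<Longrightarrow> f \<in> hom C X X' \<Longrightarrow> g \<in> hom C Y Y' \<Longrightarrow>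
   sum_map C P X Y X' Y' f g \<in> hom C (sum_ob P X Y) (sum_ob P X' Y')"
  by (simp add: sum_map_def)

lemma cotuple_inj1_comp [simp]:
  assumes "is_category C" "has_coproducts C P" "f \<in> hom C X Z" "g \<in> hom C Y Z" "h \<in> hom C W X"
  shows "cmp C W (sum_ob P X Y) Z (cotuple C P X Y Z f g) (cmp C W X (sum_ob P X Y) (inj1 P X Y) h) =
    cmp C W X Z f h"
  using assms by (simp flip: comp_assoc)

lemma cotuple_inj2_comp [simp]:
  assumes "is_category C" "has_coproducts C P" "f \<in> hom C X Z" "g \<in> hom C Y Z" "h \<in> hom C W Y"
  shows "cmp C W (sum_ob P X Y) Z (cotuple C P X Y Z f g) (cmp C W Y (sum_ob P X Y) (inj2 P X Y) h) =
    cmp C W Y Z g h"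
  using assms by (simp flip: comp_assoc)

lemma cotuple_sum_map:
  assumes "is_category C" "has_coproducts C P" "f \<in> hom C X X'" "g \<in> hom C Y Y'"
    and "h \<in> hom C X' Z" "k \<in> hom C Y' Z"
  shows "cmp C (sum_ob P X Y) (sum_ob P X' Y') Z (cotuple C P X' Y' Z h k) (sum_map C P X Y X' Y' f g) =
    cotuple C P X Y Z (cmp C X X' Z h f) (cmp C Y Y' Z k g)"
  using assms by (simp add: sum_map_def comp_cotuple)

lemma plus_id_functor:
  assumes [simp]: "is_category C" "has_coproducts C P" "is_functor C F"
  shows "is_functor C (plus_id C P F)"
  unfolding is_functor_def
proof (intro conjI allI ballI)
  fix X show "ar (plus_id C P F) X X (idm C X) = idm C (ob (plus_id C P F) X)"
    by (simp add: plus_id_def sum_map_def, rule sym, rule cotuple_unique)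
      (simp_all add: is_cotuple_def)
qed (simp_all add: plus_id_def functor_comp sum_map_def comp_cotuple comp_assoc)


section \<open>Free algebras and free monads\<close>

text \<open>This is \<open>is_alg_ext\<close> stripped of the condition on generators: homomorphisms
  compose, whereas the values on generators are compared by rewriting.\<close>

definition is_alg_hom ::
  "('o, 'a) cat \<Rightarrow> ('o, 'a) endofunctor \<Rightarrow> 'o \<Rightarrow> 'a \<Rightarrow> 'o \<Rightarrow> 'a \<Rightarrow> 'a \<Rightarrow> bool" where
  "is_alg_hom C F A a B b h \<longleftrightarrow>
     h \<in> hom C A B \<and> cmp C (ob F A) A B h a = cmp C (ob F A) (ob F B) B b (ar F A B h)"

lemma is_alg_ext_iff:
  "is_alg_ext C F X A \<phi> u B b f h \<longleftrightarrow> is_alg_hom C F A \<phi> B b h \<and> cmp C X A B h u = f"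
  by (auto simp: is_alg_ext_def is_alg_hom_def)

lemma is_alg_hom_hom: "is_alg_hom C F A a B b h \<Longrightarrow> h \<in> hom C A B"
  by (simp add: is_alg_hom_def)

lemma is_alg_hom_comp:
  assumes [simp]: "is_category C" "is_functor C F"
    and h: "is_alg_hom C F A a B b h" and k: "is_alg_hom C F B b D d k"
    and [simp]: "a \<in> hom C (ob F A) A" "b \<in> hom C (ob F B) B" "d \<in> hom C (ob F D) D"
  shows "is_alg_hom C F A a D d (cmp C A B D k h)"
proof -
  have [simp]: "h \<in> hom C A B" "k \<in> hom C B D" using h k by (simp_all add: is_alg_hom_def)
  have "cmp C (ob F A) A D (cmp C A B D k h) a
      = cmp C (ob F A) B D k (cmp C (ob F A) (ob F B) B b (ar F A B h))"
    using h by (simp add: comp_assoc is_alg_hom_def)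
  also have "\<dots> = cmp C (ob F A) (ob F D) D d (cmp C (ob F A) (ob F B) (ob F D) (ar F B D k) (ar F A B h))"
    using k by (intro comp_reassoc) (simp_all add: is_alg_hom_def)
  finally show ?thesis by (simp add: is_alg_hom_def functor_comp)
qed

lemma is_alg_hom_id:
  "is_category C \<Longrightarrow> is_functor C F \<Longrightarrow> a \<in> hom C (ob F A) A \<Longrightarrow> is_alg_hom C F A a A a (idm C A)"
  by (simp add: is_alg_hom_def)

text \<open>Both arrows solve the same extension problem. This uniqueness half of freeness is what
  proves equations out of free algebras.\<close>

lemma free_algebra_eqI:
  assumes "is_free_algebra C F X A \<phi> u" "b \<in> hom C (ob F B) B"
    and "is_alg_hom C F A \<phi> B b h" "is_alg_hom C F A \<phi> B b k"
    and "cmp C X A B h u = cmp C X A B k u" "cmp C X A B k u \<in> hom C X B"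
  shows "h = k"
  using assms unfolding is_free_algebra_def is_alg_ext_iff by metis

text \<open>The category is arbitrary because the construction is later instantiated with the
  Kleisli category, using the images of the free algebras of the base category.\<close>

locale free_algebras =
  fixes C :: "('o, 'a) cat" and F :: "('o, 'a) endofunctor"
    and A :: "'o \<Rightarrow> 'o" and \<phi> u :: "'o \<Rightarrow> 'a"
  assumes category [simp]: "is_category C"
    and functor_F [simp]: "is_functor C F"
    and free: "is_free_algebra C F X (A X) (\<phi> X) (u X)"
begin

abbreviation "M \<equiv> free_algebra_monad C F A \<phi> u"

lemma structure_hom [simp]: "\<phi> X \<in> hom C (ob F (A X)) (A X)" "u X \<in> hom C X (A X)"
  using free[of X] by (simp_all add: is_free_algebra_def)

lemma ob_M [simp]: "ob M = A" and unit_M [simp]: "unit M = u"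
  by (simp_all add: free_algebra_monad_def)

text \<open>Freeness ensures that the definite description in \<open>free_algebra_monad\<close>
  denotes, which makes its defining properties available.\<close>

lemma ar_M:
  assumes "f \<in> hom C X Y"
  shows "is_alg_hom C F (A X) (\<phi> X) (A Y) (\<phi> Y) (ar M X Y f)"
    and "cmp C X (A X) (A Y) (ar M X Y f) (u X) = cmp C X Y (A Y) (u Y) f"
proof -
  have "is_alg_ext C F X (A X) (\<phi> X) (u X) (A Y) (\<phi> Y) (cmp C X Y (A Y) (u Y) f) (ar M X Y f)"
    unfolding free_algebra_monad_def endofunctor.simps
    by (rule theI') (use free[of X] assms in \<open>simp add: is_free_algebra_def\<close>)
  then show "is_alg_hom C F (A X) (\<phi> X) (A Y) (\<phi> Y) (ar M X Y f)"
    and "cmp C X (A X) (A Y) (ar M X Y f) (u X) = cmp C X Y (A Y) (u Y) f"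
    by (simp_all add: is_alg_ext_iff)
qed

lemma mult_M:
  shows "is_alg_hom C F (A (A X)) (\<phi> (A X)) (A X) (\<phi> X) (mult M X)"
    and "cmp C (A X) (A (A X)) (A X) (mult M X) (u (A X)) = idm C (A X)"
proof -
  have "is_alg_ext C F (A X) (A (A X)) (\<phi> (A X)) (u (A X)) (A X) (\<phi> X) (idm C (A X)) (mult M X)"
    unfolding free_algebra_monad_def monad.simps
    by (rule theI') (use free[of "A X"] in \<open>simp add: is_free_algebra_def\<close>)
  then show "is_alg_hom C F (A (A X)) (\<phi> (A X)) (A X) (\<phi> X) (mult M X)"
    and "cmp C (A X) (A (A X)) (A X) (mult M X) (u (A X)) = idm C (A X)"
    by (simp_all add: is_alg_ext_iff)
qed

lemma M_hom [simp]:
  "f \<in> hom C X Y \<Longrightarrow> ar M X Y f \<in> hom C (A X) (A Y)"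
  "mult M X \<in> hom C (A (A X)) (A X)"
  using ar_M(1) mult_M(1) by (blast intro: is_alg_hom_hom)+

lemma ar_M_unit_comp:
  assumes "f \<in> hom C X Y" "g \<in> hom C W X"
  shows "cmp C W (A X) (A Y) (ar M X Y f) (cmp C W X (A X) (u X) g) =
    cmp C W Y (A Y) (u Y) (cmp C W X Y f g)"
  using assms by (intro comp_reassoc ar_M(2)) auto

lemma mult_M_unit_comp:
  assumes "g \<in> hom C W (A X)"
  shows "cmp C W (A (A X)) (A X) (mult M X) (cmp C W (A X) (A (A X)) (u (A X)) g) = g"
  using assms by (simp add: mult_M(2) flip: comp_assoc)

lemma alg_hom_eqI:
  assumes "is_alg_hom C F (A X) (\<phi> X) B b h" "is_alg_hom C F (A X) (\<phi> X) B b k"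
    and "b \<in> hom C (ob F B) B"
    and "cmp C X (A X) B h (u X) = cmp C X (A X) B k (u X)"
  shows "h = k"
  using assms free_algebra_eqI[OF free, of b B X h k] is_alg_hom_hom[OF assms(2)] by simp

lemmas alg_hom_rules = ar_M(1) mult_M(1) is_alg_hom_comp[OF category functor_F]

text \<open>Naturality of the unit and one unit law are the defining equations of
  \<open>ar M\<close> and \<open>mult M\<close>. Every other equation is between homomorphisms out
  of a free algebra, so it need only be checked on generators.\<close>

theorem free_algebra_monad_is_monad: "is_monad C M"
proof -
  have M: "is_functor C M"
    unfolding is_functor_def
  proof (intro conjI allI ballI)
    fix X show "ar M X X (idm C X) = idm C (ob M X)"
      by (rule alg_hom_eqI[of X "A X" "\<phi> X"]) (simp_all add: ar_M is_alg_hom_id)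
  next
    fix X Y Z f g assume [simp]: "f \<in> hom C X Y" "g \<in> hom C Y Z"
    show "ar M X Z (cmp C X Y Z g f) = cmp C (ob M X) (ob M Y) (ob M Z) (ar M Y Z g) (ar M X Y f)"
      unfolding ob_M
      by (rule alg_hom_eqI[of X "A Z" "\<phi> Z"])
        ((rule alg_hom_rules | simp add: ar_M(2) comp_assoc ar_M_unit_comp)+)
  qed simp
  have unit: "is_nat_trans C id_functor M (unit M)"
    unfolding is_nat_trans_def id_functor_def by (simp add: ar_M)
  have mult: "is_nat_trans C (comp_functor M M) M (mult M)"
    unfolding is_nat_trans_def
  proof (intro conjI allI ballI)
    fix X Y f assume [simp]: "f \<in> hom C X Y"
    have "cmp C (A (A X)) (A (A Y)) (A Y) (mult M Y) (ar M (A X) (A Y) (ar M X Y f)) =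
      cmp C (A (A X)) (A X) (A Y) (ar M X Y f) (mult M X)"
      by (rule alg_hom_eqI[of "A X" "A Y" "\<phi> Y"])
        ((rule alg_hom_rules | simp add: ar_M(2) mult_M(2) comp_assoc mult_M_unit_comp)+)
    then show "cmp C (ob (comp_functor M M) X) (ob (comp_functor M M) Y) (ob M Y) (mult M Y)
        (ar (comp_functor M M) X Y f) =
      cmp C (ob (comp_functor M M) X) (ob M X) (ob M Y) (ar M X Y f) (mult M X)"
      by (simp add: comp_functor_def)
  qed (simp add: comp_functor_def)
  have "cmp C (A X) (A (A X)) (A X) (mult M X) (ar M X (A X) (u X)) = idm C (A X)" for X
    by (rule alg_hom_eqI[of X "A X" "\<phi> X"])
        ((rule alg_hom_rules is_alg_hom_id | simp add: ar_M(2) comp_assoc mult_M_unit_comp)+)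
  moreover have "cmp C (A (A (A X))) (A (A X)) (A X) (mult M X) (mult M (A X)) =
      cmp C (A (A (A X))) (A (A X)) (A X) (mult M X) (ar M (A (A X)) (A X) (mult M X))" for X
    by (rule alg_hom_eqI[of "A (A X)" "A X" "\<phi> X"])
        ((rule alg_hom_rules | simp add: ar_M(2) mult_M(2) comp_assoc mult_M_unit_comp)+)
  ultimately show ?thesis
    unfolding is_monad_def Let_def using M unit mult by (simp add: mult_M(2))
qed

text \<open>The insertion of a single layer of \<open>F\<close> over the generators; it will be the
  universal natural transformation of the free monad.\<close>

definition embedding :: "'o \<Rightarrow> 'a" where
  "embedding X = cmp C (ob F X) (ob F (A X)) (A X) (\<phi> X) (ar F X (A X) (u X))"

lemma embedding_hom [simp]: "embedding X \<in> hom C (ob F X) (A X)"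
  by (simp add: embedding_def)

text \<open>\<open>mult M X\<close> is a homomorphism and a retraction of \<open>u (A X)\<close>, so
  the layer inserted by the embedding collapses again. The algebra structure is thus recovered from
  data that monad morphisms over \<open>F\<close> preserve.\<close>

lemma structure_eq_mult_embedding:
  "cmp C (ob F (A X)) (A (A X)) (A X) (mult M X) (embedding (A X)) = \<phi> X"
proof -
  have "cmp C (ob F (A X)) (A (A X)) (A X) (mult M X) (embedding (A X)) =
     cmp C (ob F (A X)) (ob F (A X)) (A X) (\<phi> X)
       (cmp C (ob F (A X)) (ob F (A (A X))) (ob F (A X)) (ar F (A (A X)) (A X) (mult M X))
          (ar F (A X) (A (A X)) (u (A X))))"
    unfolding embedding_def using mult_M(1)[of X]
    by (intro comp_reassoc) (simp_all add: is_alg_hom_def)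
  then show ?thesis by (simp add: mult_M(2) flip: functor_comp)
qed

lemma embedding_natural: "is_nat_trans C F M embedding"
  unfolding is_nat_trans_def
proof (intro conjI allI ballI)
  fix X Y f assume [simp]: "f \<in> hom C X Y"
  have "cmp C (ob F X) (A X) (A Y) (ar M X Y f) (embedding X) =
     cmp C (ob F X) (ob F (A Y)) (A Y) (\<phi> Y)
       (cmp C (ob F X) (ob F (A X)) (ob F (A Y)) (ar F (A X) (A Y) (ar M X Y f)) (ar F X (A X) (u X)))"
    unfolding embedding_def using ar_M(1)[of f X Y]
    by (intro comp_reassoc) (simp_all add: is_alg_hom_def)
  also have "\<dots> = cmp C (ob F X) (ob F Y) (A Y) (embedding Y) (ar F X Y f)"
    by (simp add: ar_M(2) embedding_def comp_assoc flip: functor_comp)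
  finally show "cmp C (ob F X) (ob F Y) (ob M Y) (embedding Y) (ar F X Y f) =
       cmp C (ob F X) (ob M X) (ob M Y) (ar M X Y f) (embedding X)" by simp
qed simp

text \<open>Write \<open>\<phi> X\<close> as multiplication after embedding and push
  \<open>h\<close> through with the multiplication law. This is the core of uniqueness in the
  universal property: \<open>h\<close> is determined by its values on generators.\<close>

lemma monad_morphism_is_alg_hom:
  assumes [simp]: "is_monad C S" and s: "is_nat_trans C F S s"
    and h: "is_monad_morphism C M S h"
    and hs: "\<And>X. cmp C (ob F X) (A X) (ob S X) (h X) (embedding X) = s X"
  shows "is_alg_hom C F (A X) (\<phi> X) (ob S X)
    (cmp C (ob F (ob S X)) (ob S (ob S X)) (ob S X) (mult S X) (s (ob S X))) (h X)"
proof -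
  have [simp]: "s X \<in> hom C (ob F X) (ob S X)" for X using s by (rule nat_trans_hom)
  have hn: "is_nat_trans C M S h" using h by (simp add: is_monad_morphism_def)
  have [simp]: "h X \<in> hom C (A X) (ob S X)" for X using nat_trans_hom[OF hn, of X] by simp
  have "cmp C (ob F (A X)) (A X) (ob S X) (h X) (\<phi> X) =
      cmp C (ob F (A X)) (A X) (ob S X) (h X)
        (cmp C (ob F (A X)) (A (A X)) (A X) (mult M X) (embedding (A X)))"
    by (simp add: structure_eq_mult_embedding)
  also have "\<dots> = cmp C (ob F (A X)) (ob S (ob S X)) (ob S X) (mult S X)
      (cmp C (ob F (A X)) (A (A X)) (ob S (ob S X))
         (cmp C (A (A X)) (ob S (A X)) (ob S (ob S X)) (ar S (A X) (ob S X) (h X)) (h (A X)))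
         (embedding (A X)))"
    using h unfolding is_monad_morphism_def Let_def by (intro comp_reassoc) simp_all
  also have "\<dots> = cmp C (ob F (A X)) (ob S (ob S X)) (ob S X) (mult S X)
      (cmp C (ob F (A X)) (ob F (ob S X)) (ob S (ob S X)) (s (ob S X)) (ar F (A X) (ob S X) (h X)))"
    by (simp add: comp_assoc hs naturality[OF s])
  finally show ?thesis
    by (simp add: is_alg_hom_def comp_assoc)
qed

text \<open>The transformation \<open>s\<close> turns each \<open>ob S X\<close> into an algebra
  \<open>b X\<close>, and the monad morphism \<open>j\<close> is the homomorphic extension of
  \<open>unit S X\<close>. A competitor is also a homomorphism and agrees on generators because it
  preserves units.\<close>

theorem free_algebra_monad_is_free: "is_free_monad_over C F M embedding"
  unfolding is_free_monad_over_def
proof (intro conjI allI impI free_algebra_monad_is_monad embedding_natural)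
  fix S s assume "is_monad C S \<and> is_nat_trans C F S s"
  then have S [simp]: "is_monad C S" and s: "is_nat_trans C F S s" by auto
  have [simp]: "s X \<in> hom C (ob F X) (ob S X)" for X using s by (rule nat_trans_hom)
  define b where
    "b X = cmp C (ob F (ob S X)) (ob S (ob S X)) (ob S X) (mult S X) (s (ob S X))" for X
  have [simp]: "b X \<in> hom C (ob F (ob S X)) (ob S X)" for X by (simp add: b_def)
  have "\<exists>j. \<forall>X. is_alg_ext C F X (A X) (\<phi> X) (u X) (ob S X) (b X) (unit S X) (j X)"
  proof (intro choice allI)
    fix X
    have "\<exists>!h. is_alg_ext C F X (A X) (\<phi> X) (u X) (ob S X) (b X) (unit S X) h"
      using free[of X] by (simp add: is_free_algebra_def)
    then show "\<exists>h. is_alg_ext C F X (A X) (\<phi> X) (u X) (ob S X) (b X) (unit S X) h" by blast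
  qed
  then obtain j where j: "\<And>X. is_alg_hom C F (A X) (\<phi> X) (ob S X) (b X) (j X)"
    and ju: "\<And>X. cmp C X (A X) (ob S X) (j X) (u X) = unit S X"
    by (auto simp: is_alg_ext_iff)
  have [simp]: "j X \<in> hom C (A X) (ob S X)" for X using j by (blast intro: is_alg_hom_hom)
  have ju_comp: "cmp C W (A X) (ob S X) (j X) (cmp C W X (A X) (u X) g) = cmp C W X (ob S X) (unit S X) g"
    if "g \<in> hom C W X" for W X g using that by (simp add: ju flip: comp_assoc)
  \<comment> \<open>Once \<open>ar S\<close> and \<open>mult S\<close> are known to be homomorphisms
    for \<open>b\<close>, both sides of the naturality and multiplication laws for \<open>j\<close>
    are homomorphisms out of a free algebra.\<close>
  have alg_ar: "is_alg_hom C F (ob S X) (b X) (ob S Y) (b Y) (ar S X Y f)" if [simp]: "f \<in> hom C X Y" for X Y f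
    unfolding is_alg_hom_def b_def
    by (simp add: comp_assoc mult_natural_comp naturality[OF s])
  have alg_mult: "is_alg_hom C F (ob S (ob S X)) (b (ob S X)) (ob S X) (b X) (mult S X)" for X
    unfolding is_alg_hom_def b_def
    by (simp add: comp_assoc mult_assoc_comp naturality[OF s])
  have j_nat: "is_nat_trans C M S j"
    unfolding is_nat_trans_def
  proof (intro conjI allI ballI)
    fix X Y f assume [simp]: "f \<in> hom C X Y"
    show "cmp C (ob M X) (ob M Y) (ob S Y) (j Y) (ar M X Y f) =
       cmp C (ob M X) (ob S X) (ob S Y) (ar S X Y f) (j X)"
      unfolding ob_M
      by (rule alg_hom_eqI[of X "ob S Y" "b Y"])
        ((rule alg_hom_rules j alg_ar | simp add: ar_M(2) comp_assoc ju ju_comp unit_natural)+)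
  qed simp
  have j_mult: "cmp C (A (A X)) (A X) (ob S X) (j X) (mult M X) =
      cmp C (A (A X)) (ob S (ob S X)) (ob S X) (mult S X)
        (cmp C (A (A X)) (ob S (A X)) (ob S (ob S X)) (ar S (A X) (ob S X) (j X)) (j (A X)))" for X
    by (rule alg_hom_eqI[of "A X" "ob S X" "b X"])
        ((rule alg_hom_rules j alg_ar alg_mult | simp add: mult_M(2) comp_assoc ju unit_natural)+)
  have j_embedding: "cmp C (ob F X) (A X) (ob S X) (j X) (embedding X) = s X" for X
  proof -
    have "cmp C (ob F X) (A X) (ob S X) (j X) (embedding X) =
      cmp C (ob F X) (ob F (ob S X)) (ob S X) (b X)
        (cmp C (ob F X) (ob F (A X)) (ob F (ob S X)) (ar F (A X) (ob S X) (j X)) (ar F X (A X) (u X)))"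
      unfolding embedding_def using j[of X] by (intro comp_reassoc) (simp_all add: is_alg_hom_def)
    also have "\<dots> = s X"
      by (simp add: ju b_def comp_assoc naturality[OF s] flip: functor_comp)
    finally show ?thesis .
  qed
  show "\<exists>!h. is_monad_morphism C M S h \<and>
    (\<forall>X. cmp C (ob F X) (ob M X) (ob S X) (h X) (embedding X) = s X)"
  proof (rule ex1I[of _ j], intro conjI allI)
    show "is_monad_morphism C M S j"
      unfolding is_monad_morphism_def Let_def using j_nat j_mult by (simp add: ju)
  next
    fix h assume h: "is_monad_morphism C M S h \<and>
      (\<forall>X. cmp C (ob F X) (ob M X) (ob S X) (h X) (embedding X) = s X)"
    show "h = j"
    proof
      fix X
      have "is_alg_hom C F (A X) (\<phi> X) (ob S X) (b X) (h X)"
        unfolding b_def using h by (intro monad_morphism_is_alg_hom) (auto simp: s)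
      then show "h X = j X"
        by (rule alg_hom_eqI) (use j h in \<open>auto simp: is_monad_morphism_def ju\<close>)
    qed
  qed (simp add: j_embedding)
qed

end

section \<open>Monad morphisms and uniqueness of free monads\<close>

lemma monad_morphism_id:
  assumes [simp]: "is_category C" "is_monad C S"
  shows "is_monad_morphism C S S (\<lambda>X. idm C (ob S X))"
  unfolding is_monad_morphism_def is_nat_trans_def Let_def by simp

lemma monad_morphism_comp:
  assumes [simp]: "is_category C" "is_monad C S" "is_monad C S'" "is_monad C S''"
    and h: "is_monad_morphism C S S' h" and k: "is_monad_morphism C S' S'' k"
  shows "is_monad_morphism C S S'' (\<lambda>X. cmp C (ob S X) (ob S' X) (ob S'' X) (k X) (h X))"
proof -
  have hn: "is_nat_trans C S S' h" and kn: "is_nat_trans C S' S'' k"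
    using h k unfolding is_monad_morphism_def by auto
  have [simp]: "h X \<in> hom C (ob S X) (ob S' X)" "k X \<in> hom C (ob S' X) (ob S'' X)" for X
    using hn kn by (auto intro: nat_trans_hom)
  have hu: "cmp C X (ob S X) (ob S' X) (h X) (unit S X) = unit S' X"
    and ku: "cmp C X (ob S' X) (ob S'' X) (k X) (unit S' X) = unit S'' X" for X
    using h k unfolding is_monad_morphism_def by auto
  have hm: "cmp C (ob S (ob S X)) (ob S X) (ob S' X) (h X) (mult S X) =
      cmp C (ob S (ob S X)) (ob S' (ob S' X)) (ob S' X) (mult S' X)
        (cmp C (ob S (ob S X)) (ob S' (ob S X)) (ob S' (ob S' X)) (ar S' (ob S X) (ob S' X) (h X)) (h (ob S X)))"
    for X using h unfolding is_monad_morphism_def Let_def by blast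
  have km: "cmp C (ob S' (ob S' X)) (ob S' X) (ob S'' X) (k X) (mult S' X) =
      cmp C (ob S' (ob S' X)) (ob S'' (ob S'' X)) (ob S'' X) (mult S'' X)
        (cmp C (ob S' (ob S' X)) (ob S'' (ob S' X)) (ob S'' (ob S'' X)) (ar S'' (ob S' X) (ob S'' X) (k X)) (k (ob S' X)))"
    for X using k unfolding is_monad_morphism_def Let_def by blast
  have km_comp: "cmp C W (ob S' X) (ob S'' X) (k X) (cmp C W (ob S' (ob S' X)) (ob S' X) (mult S' X) g) =
      cmp C W (ob S'' (ob S'' X)) (ob S'' X) (mult S'' X)
        (cmp C W (ob S'' (ob S' X)) (ob S'' (ob S'' X)) (ar S'' (ob S' X) (ob S'' X) (k X))
          (cmp C W (ob S' (ob S' X)) (ob S'' (ob S' X)) (k (ob S' X)) g))"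
    if "g \<in> hom C W (ob S' (ob S' X))" for W X g
    using that comp_reassoc[OF _ km[of X], where h = g and W = W] by (simp add: comp_assoc)
  show ?thesis
    unfolding is_monad_morphism_def Let_def
  proof (intro conjI allI)
    show "is_nat_trans C S S'' (\<lambda>X. cmp C (ob S X) (ob S' X) (ob S'' X) (k X) (h X))"
      unfolding is_nat_trans_def
      by (auto simp: comp_assoc naturality[OF hn]
          naturality_comp[where F = S' and G = S'' and t = k, OF _ _ _ kn])
  next
    fix X
    show "cmp C X (ob S X) (ob S'' X) (cmp C (ob S X) (ob S' X) (ob S'' X) (k X) (h X)) (unit S X) = unit S'' X"
      by (simp add: comp_assoc hu ku)
  next
    fix X
    show "cmp C (ob S (ob S X)) (ob S X) (ob S'' X) (cmp C (ob S X) (ob S' X) (ob S'' X) (k X) (h X)) (mult S X) =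
      cmp C (ob S (ob S X)) (ob S'' (ob S'' X)) (ob S'' X) (mult S'' X)
        (cmp C (ob S (ob S X)) (ob S'' (ob S X)) (ob S'' (ob S'' X))
          (ar S'' (ob S X) (ob S'' X) (cmp C (ob S X) (ob S' X) (ob S'' X) (k X) (h X)))
          (cmp C (ob S (ob S X)) (ob S' (ob S X)) (ob S'' (ob S X)) (k (ob S X)) (h (ob S X))))"
      by (simp add: comp_assoc hm km_comp functor_comp
          naturality_comp[where F = S' and G = S'' and t = k, OF _ _ _ kn])
  qed
qed

theorem free_monad_unique:
  assumes [simp]: "is_category C" "is_functor C F"
    and S: "is_free_monad_over C F S \<nu>" and S': "is_free_monad_over C F S' \<nu>'"
  obtains j k where "is_monad_morphism C S S' j" "is_monad_morphism C S' S k"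
    and "\<And>X. cmp C (ob F X) (ob S X) (ob S' X) (j X) (\<nu> X) = \<nu>' X"
    and "\<And>X. cmp C (ob S X) (ob S' X) (ob S X) (k X) (j X) = idm C (ob S X)"
    and "\<And>X. cmp C (ob S' X) (ob S X) (ob S' X) (j X) (k X) = idm C (ob S' X)"
proof -
  \<comment> \<open>The composite and the identity are both monad endomorphisms of \<open>S\<close>
    fixing \<open>\<nu>\<close>, hence equal by universality. Stated for any pair of free monads,
    the fact yields both inverse laws.\<close>
  have inv: "cmp C (ob S X) (ob S' X) (ob S X) (k X) (j X) = idm C (ob S X)"
    if S: "is_free_monad_over C F S \<nu>" and S': "is_free_monad_over C F S' \<nu>'"
      and j: "is_monad_morphism C S S' j" and k: "is_monad_morphism C S' S k"
      and j\<nu>: "\<And>X. cmp C (ob F X) (ob S X) (ob S' X) (j X) (\<nu> X) = \<nu>' X"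
      and k\<nu>: "\<And>X. cmp C (ob F X) (ob S' X) (ob S X) (k X) (\<nu>' X) = \<nu> X"
    for S S' \<nu> \<nu>' j k X
  proof -
    have [simp]: "is_monad C S" "is_monad C S'" and \<nu>: "is_nat_trans C F S \<nu>"
      using S S' unfolding is_free_monad_over_def by auto
    have [simp]: "\<nu> X \<in> hom C (ob F X) (ob S X)" "j X \<in> hom C (ob S X) (ob S' X)"
        "k X \<in> hom C (ob S' X) (ob S X)" for X
      using \<nu> j k unfolding is_monad_morphism_def by (auto intro: nat_trans_hom)
    have "\<exists>!h. is_monad_morphism C S S h \<and> (\<forall>X. cmp C (ob F X) (ob S X) (ob S X) (h X) (\<nu> X) = \<nu> X)"
      using S \<nu> unfolding is_free_monad_over_def by blast
    then have unique: "h = h'" if "is_monad_morphism C S S h" "is_monad_morphism C S S h'"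
        "\<And>X. cmp C (ob F X) (ob S X) (ob S X) (h X) (\<nu> X) = \<nu> X"
        "\<And>X. cmp C (ob F X) (ob S X) (ob S X) (h' X) (\<nu> X) = \<nu> X" for h h'
      using that by blast
    have "(\<lambda>X. cmp C (ob S X) (ob S' X) (ob S X) (k X) (j X)) = (\<lambda>X. idm C (ob S X))"
      by (rule unique) (use monad_morphism_comp[OF _ _ _ _ j k] in
          \<open>simp_all add: comp_assoc j\<nu> k\<nu> monad_morphism_id\<close>)
    then show ?thesis by (rule fun_cong)
  qed
  obtain j where j: "is_monad_morphism C S S' j" "\<And>X. cmp C (ob F X) (ob S X) (ob S' X) (j X) (\<nu> X) = \<nu>' X"
    using S S' unfolding is_free_monad_over_def by metis
  obtain k where k: "is_monad_morphism C S' S k" "\<And>X. cmp C (ob F X) (ob S' X) (ob S X) (k X) (\<nu>' X) = \<nu> X"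
    using S S' unfolding is_free_monad_over_def by metis
  show thesis
    by (rule that[OF j(1) k(1) j(2) inv[OF S S' j(1) k(1) j(2) k(2)] inv[OF S' S k(1) j(1) k(2) j(2)]])
qed


section \<open>Kleisli categories\<close>

lemma hom_Kl: "hom (Kl C T) X Y = hom C X (ob T Y)"
  and idm_Kl: "idm (Kl C T) X = unit T X"
  and cmp_Kl: "cmp (Kl C T) X Y Z g f =
    cmp C X (ob T (ob T Z)) (ob T Z) (mult T Z) (cmp C X (ob T Y) (ob T (ob T Z)) (ar T Y (ob T Z) g) f)"
  by (simp_all add: Kl_def)

lemma Kl_category:
  assumes [simp]: "is_category C" "is_monad C T"
  shows "is_category (Kl C T)"
  unfolding is_category_def hom_Kl idm_Kl cmp_Kl
  by (auto simp: unit_natural comp_assoc functor_comp mult_natural_comp mult_assoc_comp)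

lemma sharp_hom [simp]:
  "is_category C \<Longrightarrow> is_monad C T \<Longrightarrow> f \<in> hom C X Y \<Longrightarrow> sharp C T X Y f \<in> hom (Kl C T) X Y"
  by (simp add: sharp_def hom_Kl)

lemma Kl_comp_sharp:
  assumes "is_category C" "is_monad C T" "f \<in> hom C X Y" "g \<in> hom (Kl C T) Y Z"
  shows "cmp (Kl C T) X Y Z g (sharp C T X Y f) = cmp C X Y (ob T Z) g f"
  using assms by (simp add: sharp_def hom_Kl cmp_Kl unit_natural_comp)

lemma Kl_sharp_comp:
  assumes "is_category C" "is_monad C T" "f \<in> hom (Kl C T) X Y" "g \<in> hom C Y Z"
  shows "cmp (Kl C T) X Y Z (sharp C T Y Z g) f = cmp C X (ob T Y) (ob T Z) (ar T Y Z g) f"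
  using assms by (simp add: sharp_def hom_Kl cmp_Kl functor_comp comp_assoc)

lemma sharp_comp:
  assumes "is_category C" "is_monad C T" "f \<in> hom C X Y" "g \<in> hom C Y Z"
  shows "sharp C T X Z (cmp C X Y Z g f) = cmp (Kl C T) X Y Z (sharp C T Y Z g) (sharp C T X Y f)"
  using assms by (simp add: Kl_comp_sharp) (simp add: sharp_def comp_assoc)

lemma sum_ob_Kl [simp]: "sum_ob (Kl_coprods C T P) = sum_ob P"
  by (simp add: Kl_coprods_def)

text \<open>Precomposing with a sharpened injection is plain composition in \<open>C\<close>, so a
  Kleisli cotuple into \<open>Z\<close> is a cotuple in \<open>C\<close> into
  \<open>ob T Z\<close>.\<close>

lemma Kl_is_cotuple_iff:
  assumes "is_category C" "is_monad C T" "has_coproducts C P"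
  shows "is_cotuple (Kl C T) (Kl_coprods C T P) X Y Z f g h \<longleftrightarrow> is_cotuple C P X Y (ob T Z) f g h"
  using assms by (auto simp: is_cotuple_def Kl_coprods_def Kl_comp_sharp hom_Kl)

lemma Kl_has_coproducts:
  assumes "is_category C" "is_monad C T" "has_coproducts C P"
  shows "has_coproducts (Kl C T) (Kl_coprods C T P)"
  unfolding has_coproducts_def Kl_is_cotuple_iff[OF assms]
  using assms(3)[unfolded has_coproducts_def] assms
  by (simp add: Kl_coprods_def) (simp add: hom_Kl)

lemma sharp_cotuple:
  assumes [simp]: "is_category C" "is_monad C T" "has_coproducts C P" "f \<in> hom C X Z" "g \<in> hom C Y Z"
  shows "sharp C T (sum_ob P X Y) Z (cotuple C P X Y Z f g) =
    cotuple (Kl C T) (Kl_coprods C T P) X Y Z (sharp C T X Z f) (sharp C T Y Z g)"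
proof (rule cotuple_unique)
  show "is_cotuple (Kl C T) (Kl_coprods C T P) X Y Z (sharp C T X Z f) (sharp C T Y Z g)
     (sharp C T (sum_ob P X Y) Z (cotuple C P X Y Z f g))"
    by (simp add: is_cotuple_def Kl_coprods_def flip: sharp_comp)
qed (simp_all add: Kl_has_coproducts)

text \<open>\<open>sharp\<close> preserves composites and cotuples, hence also the sum maps from
  which the action of \<open>plus_id\<close> is built.\<close>

lemma plus_id_lifts:
  assumes [simp]: "is_category C" "is_monad C T" "has_coproducts C P" and F: "lifts_to C T F Fbar"
  shows "lifts_to C T (plus_id C P F) (plus_id (Kl C T) (Kl_coprods C T P) Fbar)"
proof -
  have [simp]: "is_functor C F" "is_functor (Kl C T) Fbar" "\<And>X. ob Fbar X = ob F X"
    "\<And>X Y f. f \<in> hom C X Y \<Longrightarrow> ar Fbar X Y (sharp C T X Y f) = sharp C T (ob F X) (ob F Y) (ar F X Y f)"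
    using F by (simp_all add: lifts_to_def)
  have [simp]: "is_category (Kl C T)" "has_coproducts (Kl C T) (Kl_coprods C T P)"
    by (simp_all add: Kl_category Kl_has_coproducts)
  have inj: "inj1 (Kl_coprods C T P) X Y = sharp C T X (sum_ob P X Y) (inj1 P X Y)"
    "inj2 (Kl_coprods C T P) X Y = sharp C T Y (sum_ob P X Y) (inj2 P X Y)" for X Y
    by (simp_all add: Kl_coprods_def)
  show ?thesis
    unfolding lifts_to_def
    by (auto simp: plus_id_functor) (simp_all add: plus_id_def sum_map_def sharp_cotuple sharp_comp inj)
qed

section \<open>Free algebras in the Kleisli category\<close>

text \<open>
  A Kleisli algebra \<open>b\<close> on \<open>B\<close> corresponds to the algebra \<open>b \<cdot> Fbar(id)\<close> on \<open>T B\<close>, where \<open>id\<close> is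
  read as the Kleisli arrow from \<open>T B\<close> to \<open>B\<close>, the counit of the Kleisli adjunction.
\<close>

lemma Kl_free_algebra:
  assumes [simp]: "is_category C" "is_monad C T" and F: "lifts_to C T F Fbar"
    and free: "is_free_algebra C F X A \<phi> u"
  shows "is_free_algebra (Kl C T) Fbar X A (sharp C T (ob F A) A \<phi>) (sharp C T X A u)"
proof -
  have [simp]: "is_functor C F" "is_functor (Kl C T) Fbar" "\<And>X. ob Fbar X = ob F X"
    "\<And>X Y f. f \<in> hom C X Y \<Longrightarrow> ar Fbar X Y (sharp C T X Y f) = sharp C T (ob F X) (ob F Y) (ar F X Y f)"
    using F by (simp_all add: lifts_to_def)
  have K [simp]: "is_category (Kl C T)" by (simp add: Kl_category)
  have [simp]: "\<phi> \<in> hom C (ob F A) A" "u \<in> hom C X A" using free by (simp_all add: is_free_algebra_def)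
  define b' where "b' B b = cmp (Kl C T) (ob F (ob T B)) (ob F B) B b (ar Fbar (ob T B) B (idm C (ob T B)))"
    for B b
  have eps [simp]: "idm C (ob T B) \<in> hom (Kl C T) (ob T B) B" for B by (simp add: hom_Kl)
  have epsF [simp]: "ar Fbar (ob T B) B (idm C (ob T B)) \<in> hom (Kl C T) (ob F (ob T B)) (ob F B)" for B
    using functor_hom[OF _ eps, of Fbar] by simp
  have b'_hom [simp]: "b' B b \<in> hom (Kl C T) (ob F (ob T B)) B" if "b \<in> hom (Kl C T) (ob F B) B" for B b
    using that by (simp add: b'_def)
  \<comment> \<open>The two extension problems have the very same solutions \<open>h\<close>, so
    unique existence transfers from the base category.\<close>
  have ext_iff: "is_alg_ext (Kl C T) Fbar X A (sharp C T (ob F A) A \<phi>) (sharp C T X A u) B b f h \<longleftrightarrow>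
      is_alg_ext C F X A \<phi> u (ob T B) (b' B b) f h" if b [simp]: "b \<in> hom (Kl C T) (ob F B) B" for B b f h
  proof (cases "h \<in> hom (Kl C T) A B")
    case h [simp]: True
    then have h' [simp]: "h \<in> hom C A (ob T B)" by (simp add: hom_Kl)
    have Fsh [simp]: "sharp C T (ob F A) (ob F (ob T B)) (ar F A (ob T B) h) \<in> hom (Kl C T) (ob F A) (ob F (ob T B))"
      by simp
    \<comment> \<open>The action of \<open>Fbar\<close> is prescribed on sharpened arrows only;
      factoring \<open>h\<close> through the counit reduces its image to such an arrow.\<close>
    have "h = cmp (Kl C T) A (ob T B) B (idm C (ob T B)) (sharp C T A (ob T B) h)"
      by (simp add: Kl_comp_sharp)
    then have "ar Fbar A B h = ar Fbar A B (cmp (Kl C T) A (ob T B) B (idm C (ob T B)) (sharp C T A (ob T B) h))"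
      by simp
    also have "\<dots> = cmp (Kl C T) (ob F A) (ob F (ob T B)) (ob F B)
        (ar Fbar (ob T B) B (idm C (ob T B))) (sharp C T (ob F A) (ob F (ob T B)) (ar F A (ob T B) h))"
      by (simp add: functor_comp)
    finally have "cmp (Kl C T) (ob F A) (ob F B) B b (ar Fbar A B h) =
      cmp (Kl C T) (ob F A) (ob F (ob T B)) B (b' B b) (sharp C T (ob F A) (ob F (ob T B)) (ar F A (ob T B) h))"
      unfolding b'_def using comp_assoc[OF K Fsh epsF b] by simp
    also have "\<dots> = cmp C (ob F A) (ob F (ob T B)) (ob T B) (b' B b) (ar F A (ob T B) h)"
      by (simp add: Kl_comp_sharp)
    finally show ?thesis by (simp add: is_alg_ext_def Kl_comp_sharp)
  qed (simp add: is_alg_ext_def hom_Kl)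
  show ?thesis
    unfolding is_free_algebra_def
  proof (intro conjI allI ballI)
    fix B b f assume b: "b \<in> hom (Kl C T) (ob Fbar B) B" and f: "f \<in> hom (Kl C T) X B"
    have "\<exists>!h. is_alg_ext C F X A \<phi> u (ob T B) (b' B b) f h"
      using free b f b'_hom[of b B] by (simp add: is_free_algebra_def hom_Kl)
    then show "\<exists>!h. is_alg_ext (Kl C T) Fbar X A (sharp C T (ob F A) A \<phi>) (sharp C T X A u) B b f h"
      using b by (simp add: ext_iff)
  qed simp_all
qed

text \<open>Composing with a sharpened arrow on either side cancels the monad structure of
  \<open>T\<close>. The homomorphism condition thus moves into the Kleisli category, where
  saturation is defined.\<close>

lemma coalg_hom_iff:
  assumes "is_category C" "is_monad C T" and H: "lifts_to C T H S"
    and "\<alpha> \<in> hom (Kl C T) X (ob S X)" "\<gamma> \<in> hom (Kl C T) Z (ob S Z)" "f \<in> hom C X Z"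
  shows "is_coalg_hom C (comp_functor T H) X \<alpha> Z \<gamma> f \<longleftrightarrow>
    cmp (Kl C T) X (ob S X) (ob S Z) (ar S X Z (sharp C T X Z f)) \<alpha> =
    cmp (Kl C T) X Z (ob S Z) \<gamma> (sharp C T X Z f)"
  using assms by (simp add: is_coalg_hom_def comp_functor_def lifts_to_def Kl_comp_sharp Kl_sharp_comp)


section \<open>Order saturation\<close>

lemma kl_ext_hom [simp]:
  "is_category K \<Longrightarrow> is_monad K S \<Longrightarrow> \<alpha> \<in> hom K X (ob S Y) \<Longrightarrow> kl_ext K S X Y \<alpha> \<in> hom K (ob S X) (ob S Y)"
  by (simp add: kl_ext_def)

lemma kl_ext_unit:
  "is_category K \<Longrightarrow> is_monad K S \<Longrightarrow> \<alpha> \<in> hom K X (ob S Y) \<Longrightarrow>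
   cmp K X (ob S X) (ob S Y) (kl_ext K S X Y \<alpha>) (unit S X) = \<alpha>"
  by (simp add: kl_ext_def comp_assoc unit_natural)

locale order_saturation_monad =
  fixes C :: "('o, 'a) cat" and T :: "('o, 'a) monad"
    and le :: "('o, 'a) hom_order" and star :: "'o \<Rightarrow> 'a \<Rightarrow> 'a"
  assumes category [simp]: "is_category C" and monad [simp]: "is_monad C T"
    and order: "order_enriched (Kl C T) le"
    and saturation: "order_saturation C T le star"
begin

abbreviation "K \<equiv> Kl C T"

lemma category_K [simp]: "is_category K"
  by (simp add: Kl_category)

lemma le_refl [simp]: "f \<in> hom K X Y \<Longrightarrow> le X Y f f"
  using order unfolding order_enriched_def by (blast dest: reflp_onD)

lemma le_trans:
  "le X Y f g \<Longrightarrow> le X Y g h \<Longrightarrow> f \<in> hom K X Y \<Longrightarrow> g \<in> hom K X Y \<Longrightarrow> h \<in> hom K X Y \<Longrightarrow> le X Y f h"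
  using order unfolding order_enriched_def by (blast dest: transp_onD)

lemma le_antisym:
  "le X Y f g \<Longrightarrow> le X Y g f \<Longrightarrow> f \<in> hom K X Y \<Longrightarrow> g \<in> hom K X Y \<Longrightarrow> f = g"
  using order unfolding order_enriched_def by (blast dest: antisymp_onD)

lemma comp_mono:
  "le X Y f f' \<Longrightarrow> le Y Z g g' \<Longrightarrow> f \<in> hom K X Y \<Longrightarrow> f' \<in> hom K X Y \<Longrightarrow> g \<in> hom K Y Z \<Longrightarrow> g' \<in> hom K Y Z \<Longrightarrow>
   le X Z (cmp K X Y Z g f) (cmp K X Y Z g' f')"
  using order unfolding order_enriched_def by blast

lemma star_hom [simp]: "\<alpha> \<in> hom K X X \<Longrightarrow> star X \<alpha> \<in> hom K X X"
  and id_le_star: "\<alpha> \<in> hom K X X \<Longrightarrow> le X X (idm K X) (star X \<alpha>)"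
  and le_star: "\<alpha> \<in> hom K X X \<Longrightarrow> le X X \<alpha> (star X \<alpha>)"
  and star_idem: "\<alpha> \<in> hom K X X \<Longrightarrow> le X X (cmp K X X X (star X \<alpha>) (star X \<alpha>)) (star X \<alpha>)"
  using saturation unfolding order_saturation_def Let_def by blast+

lemma star_least:
  "\<alpha> \<in> hom K X X \<Longrightarrow> \<beta> \<in> hom K X X \<Longrightarrow> le X X (idm K X) \<beta> \<Longrightarrow> le X X \<alpha> \<beta> \<Longrightarrow>
   le X X (cmp K X X X \<beta> \<beta>) \<beta> \<Longrightarrow> le X X (star X \<alpha>) \<beta>"
  using saturation unfolding order_saturation_def Let_def by blast

lemma star_sharp_le:
  "\<alpha> \<in> hom K X X \<Longrightarrow> \<beta> \<in> hom K Y Y \<Longrightarrow> f \<in> hom C X Y \<Longrightarrow>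
   le X Y (cmp K X X Y (sharp C T X Y f) \<alpha>) (cmp K X Y Y \<beta> (sharp C T X Y f)) \<Longrightarrow>
   le X Y (cmp K X X Y (sharp C T X Y f) (star X \<alpha>)) (cmp K X Y Y (star Y \<beta>) (sharp C T X Y f))"
  and star_sharp_ge:
  "\<alpha> \<in> hom K X X \<Longrightarrow> \<beta> \<in> hom K Y Y \<Longrightarrow> f \<in> hom C X Y \<Longrightarrow>
   le X Y (cmp K X Y Y \<beta> (sharp C T X Y f)) (cmp K X X Y (sharp C T X Y f) \<alpha>) \<Longrightarrow>
   le X Y (cmp K X Y Y (star Y \<beta>) (sharp C T X Y f)) (cmp K X X Y (sharp C T X Y f) (star X \<alpha>))"
  using saturation unfolding order_saturation_def Let_def by blast+

section \<open>Saturation along base arrows and isomorphisms\<close>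

lemma star_sharp_eq:
  assumes "\<alpha> \<in> hom K X X" "\<beta> \<in> hom K Y Y" "f \<in> hom C X Y"
    and "cmp K X X Y (sharp C T X Y f) \<alpha> = cmp K X Y Y \<beta> (sharp C T X Y f)"
  shows "cmp K X X Y (sharp C T X Y f) (star X \<alpha>) = cmp K X Y Y (star Y \<beta>) (sharp C T X Y f)"
proof (rule le_antisym)
  show "le X Y (cmp K X X Y (sharp C T X Y f) (star X \<alpha>)) (cmp K X Y Y (star Y \<beta>) (sharp C T X Y f))"
    by (rule star_sharp_le) (use assms in simp_all)
  show "le X Y (cmp K X Y Y (star Y \<beta>) (sharp C T X Y f)) (cmp K X X Y (sharp C T X Y f) (star X \<alpha>))"
    by (rule star_sharp_ge) (use assms in simp_all)
qed (use assms in simp_all)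

text \<open>The conjugate of \<open>star Y \<gamma>\<close> lies above the identity and the
  conjugate of \<open>\<gamma>\<close>, and its square collapses since the inner \<open>i\<close>
  and \<open>j\<close> cancel. Leastness of \<open>star\<close> then applies.\<close>

lemma star_conjugate_le:
  assumes [simp]: "i \<in> hom K X Y" "j \<in> hom K Y X" "\<gamma> \<in> hom K Y Y"
    and ji: "cmp K X Y X j i = idm K X" and ij: "cmp K Y X Y i j = idm K Y"
  shows "le X X (star X (cmp K X Y X j (cmp K X Y Y \<gamma> i))) (cmp K X Y X j (cmp K X Y Y (star Y \<gamma>) i))"
proof (rule star_least)
  have "le X X (cmp K X Y X j (cmp K X Y Y (idm K Y) i)) (cmp K X Y X j (cmp K X Y Y (star Y \<gamma>) i))"
    by (intro comp_mono id_le_star) simp_all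
  then show "le X X (idm K X) (cmp K X Y X j (cmp K X Y Y (star Y \<gamma>) i))"
    by (simp add: ji)
  show "le X X (cmp K X Y X j (cmp K X Y Y \<gamma> i)) (cmp K X Y X j (cmp K X Y Y (star Y \<gamma>) i))"
    by (intro comp_mono le_star) simp_all
  have "cmp K X X Y i (cmp K X Y X j g) = g" if "g \<in> hom K X Y" for g
    using that by (simp add: ij flip: comp_assoc)
  moreover have "le X X (cmp K X Y X j (cmp K X Y Y (cmp K Y Y Y (star Y \<gamma>) (star Y \<gamma>)) i))
      (cmp K X Y X j (cmp K X Y Y (star Y \<gamma>) i))"
    by (intro comp_mono star_idem) simp_all
  ultimately show "le X X (cmp K X X X (cmp K X Y X j (cmp K X Y Y (star Y \<gamma>) i))
      (cmp K X Y X j (cmp K X Y Y (star Y \<gamma>) i))) (cmp K X Y X j (cmp K X Y Y (star Y \<gamma>) i))"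
    by (simp add: comp_assoc)
qed simp_all

text \<open>Extends the saturation axiom for inequations to arrows that come from the base category
  only up to an isomorphism \<open>i\<close>: conjugate \<open>\<gamma>\<close> by \<open>i\<close>,
  use the axiom for the base arrow, and transport back.\<close>

lemma star_iso_sharp_le:
  assumes \<alpha> [simp]: "\<alpha> \<in> hom K X X" and \<gamma> [simp]: "\<gamma> \<in> hom K Y Y"
    and f [simp]: "f \<in> hom C X W" and i [simp]: "i \<in> hom K W Y" and j [simp]: "j \<in> hom K Y W"
    and ji: "cmp K W Y W j i = idm K W" and ij: "cmp K Y W Y i j = idm K Y"
    and h: "h = cmp K X W Y i (sharp C T X W f)"
    and le: "le X Y (cmp K X X Y h \<alpha>) (cmp K X Y Y \<gamma> h)"
  shows "le X Y (cmp K X X Y h (star X \<alpha>)) (cmp K X Y Y (star Y \<gamma>) h)"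
proof -
  let ?f = "sharp C T X W f"
  have [simp]: "h \<in> hom K X Y" by (simp add: h)
  have jh: "cmp K X Y W j h = ?f" by (simp add: h ji flip: comp_assoc)
  have ij': "cmp K V W Y i (cmp K V Y W j g) = g" if "g \<in> hom K V Y" for V g
    using that by (simp add: ij flip: comp_assoc)
  have "le X W (cmp K X X W ?f \<alpha>) (cmp K X W W (cmp K W Y W j (cmp K W Y Y \<gamma> i)) ?f)"
  proof -
    have "le X W (cmp K X Y W j (cmp K X X Y h \<alpha>)) (cmp K X Y W j (cmp K X Y Y \<gamma> h))"
      by (intro comp_mono le) simp_all
    moreover
    have "cmp K X Y W j (cmp K X X Y h \<alpha>) = cmp K X X W ?f \<alpha>"
      by (simp add: jh flip: comp_assoc)
    moreover have "cmp K X Y W j (cmp K X Y Y \<gamma> h) = cmp K X W W (cmp K W Y W j (cmp K W Y Y \<gamma> i)) ?f"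
      by (simp add: h comp_assoc)
    ultimately show ?thesis by simp
  qed
  then have 1: "le X W (cmp K X X W ?f (star X \<alpha>)) (cmp K X W W (star W (cmp K W Y W j (cmp K W Y Y \<gamma> i))) ?f)"
    by (intro star_sharp_le) simp_all
  \<comment> \<open>The saturation of the conjugate is replaced by the conjugate of the saturation,
    so that \<open>i\<close> can cancel \<open>j\<close> afterwards.\<close>
  have 2: "le X W (cmp K X W W (star W (cmp K W Y W j (cmp K W Y Y \<gamma> i))) ?f)
      (cmp K X W W (cmp K W Y W j (cmp K W Y Y (star Y \<gamma>) i)) ?f)"
    by (intro comp_mono star_conjugate_le ji ij) simp_all
  have "le X W (cmp K X X W ?f (star X \<alpha>)) (cmp K X W W (cmp K W Y W j (cmp K W Y Y (star Y \<gamma>) i)) ?f)"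
    by (rule le_trans[OF 1 2]) simp_all
  then have "le X Y (cmp K X W Y i (cmp K X X W ?f (star X \<alpha>)))
      (cmp K X W Y i (cmp K X W W (cmp K W Y W j (cmp K W Y Y (star Y \<gamma>) i)) ?f))"
    by (intro comp_mono) simp_all
  then show ?thesis by (simp add: comp_assoc ij' h)
qed

section \<open>Saturation operators and the lax comparison of extensions\<close>

lemma saturate_hom [simp]:
  "is_monad K S \<Longrightarrow> \<alpha> \<in> hom K X (ob S X) \<Longrightarrow> saturate K star S X \<alpha> \<in> hom K X (ob S X)"
  by (simp add: saturate_def)

lemma le_saturate:
  assumes [simp]: "is_monad K S" "\<alpha> \<in> hom K X (ob S X)"
  shows "le X (ob S X) \<alpha> (saturate K star S X \<alpha>)"
proof -
  have "le X (ob S X) (cmp K X (ob S X) (ob S X) (kl_ext K S X X \<alpha>) (unit S X)) (saturate K star S X \<alpha>)"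
    unfolding saturate_def by (intro comp_mono le_star) simp_all
  then show ?thesis by (simp add: kl_ext_unit)
qed

text \<open>By the saturation condition the Kleisli extension of
  \<open>saturate K star S X \<beta>\<close> is itself a \<open>star\<close>, so it bounds the star
  of any smaller extension. Together with \<open>le_saturate\<close> this makes
  \<open>saturate\<close> a closure operator.\<close>

lemma saturate_le_saturate:
  assumes [simp]: "is_monad K S" and S: "locally_monotonic K le S" "saturation_condition K star S"
    and [simp]: "\<alpha> \<in> hom K X (ob S X)" "\<beta> \<in> hom K X (ob S X)"
    and le: "le X (ob S X) \<alpha> (saturate K star S X \<beta>)"
  shows "le X (ob S X) (saturate K star S X \<alpha>) (saturate K star S X \<beta>)"
proof -
  have "le (ob S X) (ob S X) (kl_ext K S X X \<alpha>) (kl_ext K S X X (saturate K star S X \<beta>))"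
    unfolding kl_ext_def using S(1) le
    by (intro comp_mono) (simp_all add: locally_monotonic_def)
  then have "le (ob S X) (ob S X) (kl_ext K S X X \<alpha>) (star (ob S X) (kl_ext K S X X \<beta>))"
    using S(2) by (simp add: saturation_condition_def)
  then have "le (ob S X) (ob S X) (star (ob S X) (kl_ext K S X X \<alpha>)) (star (ob S X) (kl_ext K S X X \<beta>))"
    by (intro star_least id_le_star star_idem) simp_all
  then show ?thesis
    unfolding saturate_def by (intro comp_mono) simp_all
qed

text \<open>The lifted functor sends \<open>sharp f\<close> to a sharpened arrow, so the saturation
  axiom applies to the square relating the two Kleisli extensions. Precomposing with the unit gives
  the claim.\<close>

lemma saturate_coalg_hom:
  assumes S [simp]: "is_monad K S" and H: "lifts_to C T H S"
    and \<alpha> [simp]: "\<alpha> \<in> hom K X (ob S X)" and \<gamma> [simp]: "\<gamma> \<in> hom K Z (ob S Z)"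
    and f [simp]: "f \<in> hom C X Z"
    and eq: "cmp K X (ob S X) (ob S Z) (ar S X Z (sharp C T X Z f)) \<alpha> =
      cmp K X Z (ob S Z) \<gamma> (sharp C T X Z f)"
  shows "cmp K X (ob S X) (ob S Z) (ar S X Z (sharp C T X Z f)) (saturate K star S X \<alpha>) =
    cmp K X Z (ob S Z) (saturate K star S Z \<gamma>) (sharp C T X Z f)"
proof -
  let ?f = "sharp C T X Z f"
  have Sf: "ar S X Z ?f = sharp C T (ob S X) (ob S Z) (ar H X Z f)"
    and Hf: "ar H X Z f \<in> hom C (ob S X) (ob S Z)"
    using H by (auto simp: lifts_to_def functor_hom[of C H, simplified])
  have "cmp K (ob S X) (ob S X) (ob S Z) (ar S X Z ?f) (kl_ext K S X X \<alpha>) =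
      cmp K (ob S X) (ob S Z) (ob S Z) (kl_ext K S Z Z \<gamma>) (ar S X Z ?f)"
    unfolding kl_ext_def
    by (simp add: mult_natural_comp comp_assoc eq flip: functor_comp)
  then have "cmp K (ob S X) (ob S X) (ob S Z) (ar S X Z ?f) (star (ob S X) (kl_ext K S X X \<alpha>)) =
      cmp K (ob S X) (ob S Z) (ob S Z) (star (ob S Z) (kl_ext K S Z Z \<gamma>)) (ar S X Z ?f)"
    unfolding Sf by (intro star_sharp_eq Hf) simp_all
  then have "cmp K X (ob S X) (ob S Z) (ar S X Z ?f) (saturate K star S X \<alpha>) =
      cmp K X (ob S Z) (ob S Z) (star (ob S Z) (kl_ext K S Z Z \<gamma>))
        (cmp K X (ob S X) (ob S Z) (ar S X Z ?f) (unit S X))"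
    unfolding saturate_def by (intro comp_reassoc) simp_all
  then show ?thesis by (simp add: unit_natural saturate_def comp_assoc)
qed

text \<open>Both sides are cotuples with the same second component
  \<open>h \<cdot> \<alpha>\<close>. On the first component the claim reduces to
  \<open>unit S X \<cdot> z \<le> h\<close>, where \<open>z\<close> is zero on the
  \<open>F\<close>-summand; this is where minimality of zero enters.\<close>

lemma cotuple_kl_ext_le:
  assumes Q [simp]: "has_coproducts K Q" and zero: "zero_morphisms K zero"
    and F [simp]: "is_functor K F" and S [simp]: "is_monad K S" and \<nu>: "is_nat_trans K F S \<nu>"
    and mono: "locally_monotonic K le S" "cotupling_monotonic K Q le"
    and least: "\<And>X Y f. f \<in> hom K X Y \<Longrightarrow> le X Y (zero X Y) f"
    and \<alpha> [simp]: "\<alpha> \<in> hom K X (sum_ob Q (ob F X) X)"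
    and h: "h = cotuple K Q (ob F X) X (ob S X) (\<nu> X) (unit S X)"
  shows "le (sum_ob Q (ob F X) X) (ob S X)
    (cmp K (sum_ob Q (ob F X) X) (sum_ob Q (ob F X) X) (ob S X) h
      (kl_ext K (tau_monad K Q zero F) X X \<alpha>))
    (cmp K (sum_ob Q (ob F X) X) (ob S X) (ob S X)
      (kl_ext K S X X (cmp K X (sum_ob Q (ob F X) X) (ob S X) h \<alpha>)) h)"
proof -
  let ?G = "sum_ob Q (ob F X) X"
  define z where "z = cotuple K Q (ob F X) X X (zero (ob F X) X) (idm K X)"
  have [simp]: "\<nu> X \<in> hom K (ob F X) (ob S X)" for X using \<nu> by (rule nat_trans_hom)
  have [simp]: "zero X Y \<in> hom K X Y" for X Y using zero by (simp add: zero_morphisms_def)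
  have [simp]: "z \<in> hom K ?G X" "h \<in> hom K ?G (ob S X)" by (simp_all add: z_def h)
  have mult: "mult (tau_monad K Q zero F) X = cotuple K Q (ob F ?G) ?G ?G
      (cmp K (ob F ?G) (ob F X) ?G (inj1 Q (ob F X) X) (ar F ?G X z)) (idm K ?G)"
    by (simp add: tau_monad_def Let_def cotuple_sum_map flip: z_def)
  have "kl_ext K (tau_monad K Q zero F) X X \<alpha> = cotuple K Q (ob F X) X ?G
      (cmp K (ob F X) (ob F X) ?G (inj1 Q (ob F X) X) (ar F X X (cmp K X ?G X z \<alpha>))) \<alpha>"
    unfolding kl_ext_def mult
    by (simp add: tau_monad_def plus_id_def cotuple_sum_map comp_assoc functor_comp)
  then have lhs: "cmp K ?G ?G (ob S X) h (kl_ext K (tau_monad K Q zero F) X X \<alpha>) =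
      cotuple K Q (ob F X) X (ob S X)
        (cmp K (ob F X) (ob S X) (ob S X) (ar S X X (cmp K X ?G X z \<alpha>)) (\<nu> X))
        (cmp K X ?G (ob S X) h \<alpha>)"
    by (simp add: comp_cotuple) (simp add: h naturality[OF \<nu>])
  have rhs: "cmp K ?G (ob S X) (ob S X) (kl_ext K S X X (cmp K X ?G (ob S X) h \<alpha>)) h =
      cotuple K Q (ob F X) X (ob S X)
        (cmp K (ob F X) (ob S X) (ob S X) (kl_ext K S X X (cmp K X ?G (ob S X) h \<alpha>)) (\<nu> X))
        (cmp K X ?G (ob S X) h \<alpha>)"
    \<comment> \<open>Only the composed \<open>h\<close> is unfolded; the copies inside the
      extension must stay folded.\<close>
    by (subst (2) h) (simp add: comp_cotuple kl_ext_unit)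
  \<comment> \<open>This cotuple differs from \<open>h\<close> only in having zero in place of
    \<open>\<nu> X\<close>, so monotone cotupling puts it below \<open>h\<close>.\<close>
  have "cmp K ?G X (ob S X) (unit S X) z = cotuple K Q (ob F X) X (ob S X) (zero (ob F X) (ob S X)) (unit S X)"
    unfolding z_def using zero by (simp add: comp_cotuple zero_morphisms_def)
  then have "le ?G (ob S X) (cmp K ?G X (ob S X) (unit S X) z) h"
    using mono(2) least by (simp add: h cotupling_monotonic_def)
  then have "le X (ob S X) (cmp K X ?G (ob S X) (cmp K ?G X (ob S X) (unit S X) z) \<alpha>) (cmp K X ?G (ob S X) h \<alpha>)"
    by (intro comp_mono) simp_all
  then have "le (ob S X) (ob S (ob S X))
      (ar S X (ob S X) (cmp K X ?G (ob S X) (cmp K ?G X (ob S X) (unit S X) z) \<alpha>))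
      (ar S X (ob S X) (cmp K X ?G (ob S X) h \<alpha>))"
    using mono(1) by (simp add: locally_monotonic_def)
  then have "le (ob S X) (ob S X)
      (cmp K (ob S X) (ob S (ob S X)) (ob S X) (mult S X)
        (ar S X (ob S X) (cmp K X ?G (ob S X) (cmp K ?G X (ob S X) (unit S X) z) \<alpha>)))
      (kl_ext K S X X (cmp K X ?G (ob S X) h \<alpha>))"
    unfolding kl_ext_def by (intro comp_mono) simp_all
  \<comment> \<open>The unit inserted in front of \<open>z\<close> is absorbed by the
    multiplication.\<close>
  then have "le (ob S X) (ob S X) (ar S X X (cmp K X ?G X z \<alpha>)) (kl_ext K S X X (cmp K X ?G (ob S X) h \<alpha>))"
    by (simp add: comp_assoc functor_comp[of K S _ X X _ "ob S X"])
  then have "le (ob F X) (ob S X)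
      (cmp K (ob F X) (ob S X) (ob S X) (ar S X X (cmp K X ?G X z \<alpha>)) (\<nu> X))
      (cmp K (ob F X) (ob S X) (ob S X) (kl_ext K S X X (cmp K X ?G (ob S X) h \<alpha>)) (\<nu> X))"
    by (intro comp_mono) simp_all
  then show ?thesis
    unfolding lhs rhs using mono(2) by (simp add: cotupling_monotonic_def)
qed

end

section \<open>Transfer of bisimulations to the free monad\<close>

theorem theorem8:
  fixes C :: "('o, 'a) cat"
    and P :: "('o, 'a) coprods"
    and T :: "('o, 'a) monad"
    and le :: "('o, 'a) hom_order"
    and star :: "'o \<Rightarrow> 'a \<Rightarrow> 'a"
    and zero :: "'o \<Rightarrow> 'o \<Rightarrow> 'a"
    and F Fbar :: "('o, 'a) endofunctor"
    and A :: "'o \<Rightarrow> 'o" and \<phi> u :: "'o \<Rightarrow> 'a"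
    and Fstar_bar :: "('o, 'a) monad"
    and \<nu> :: "'o \<Rightarrow> 'a"
  assumes "is_category C"
    and "has_coproducts C P"
    and "is_monad C T"
    and "order_enriched (Kl C T) le"
    and "order_saturation C T le star"
    and "zero_morphisms (Kl C T) zero"
    and "lifts_to C T F Fbar"
    and "is_monad (Kl C T) (tau_monad (Kl C T) (Kl_coprods C T P) zero Fbar)"
    and "\<And>X. is_free_algebra C F X (A X) (\<phi> X) (u X)"
    and "lifts_to C T (free_algebra_monad C F A \<phi> u) Fstar_bar"
    and "is_free_monad_over (Kl C T) Fbar Fstar_bar \<nu>"
    and "locally_monotonic (Kl C T) le (tau_monad (Kl C T) (Kl_coprods C T P) zero Fbar)"
    and "saturation_condition (Kl C T) star (tau_monad (Kl C T) (Kl_coprods C T P) zero Fbar)"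
    and "locally_monotonic (Kl C T) le Fstar_bar"
    and "saturation_condition (Kl C T) star Fstar_bar"
    and "cotupling_monotonic (Kl C T) (Kl_coprods C T P) le"
    and "\<And>X Y f. f \<in> hom (Kl C T) X Y \<Longrightarrow> le X Y (zero X Y) f"
    and "\<alpha> \<in> hom (Kl C T) X (ob (tau_monad (Kl C T) (Kl_coprods C T P) zero Fbar) X)"
    and "is_bisimulation C (comp_functor T (plus_id C P F))
           X (saturate (Kl C T) star (tau_monad (Kl C T) (Kl_coprods C T P) zero Fbar) X \<alpha>)
           X (saturate (Kl C T) star (tau_monad (Kl C T) (Kl_coprods C T P) zero Fbar) X \<alpha>)
           R p q"
  shows "is_bisimulation C (comp_functor T (free_algebra_monad C F A \<phi> u))
           X (saturate (Kl C T) star Fstar_bar X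
                (underline (Kl C T) (Kl_coprods C T P) Fbar Fstar_bar \<nu> X \<alpha>))
           X (saturate (Kl C T) star Fstar_bar X
                (underline (Kl C T) (Kl_coprods C T P) Fbar Fstar_bar \<nu> X \<alpha>))
           R p q"
proof -
  interpret order_saturation_monad C T le star
    by unfold_locales (rule assms)+
  define Q where "Q = Kl_coprods C T P"
  define G where "G = tau_monad K Q zero Fbar"
  define h where "h X = cotuple K Q (ob Fbar X) X (ob Fstar_bar X) (\<nu> X) (unit Fstar_bar X)" for X
  let ?S = Fstar_bar
  have P [simp]: "has_coproducts C P" by (rule assms)
  have Q [simp]: "has_coproducts K Q" unfolding Q_def by (intro Kl_has_coproducts) simp_all
  have sum_Q [simp]: "sum_ob Q = sum_ob P" by (simp add: Q_def)
  have F: "lifts_to C T F Fbar" by (rule assms)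
  have [simp]: "is_functor C F" "is_functor K Fbar" and obF [simp]: "\<And>X. ob Fbar X = ob F X"
    and sharpF: "\<And>X Y f. f \<in> hom C X Y \<Longrightarrow>
      ar Fbar X Y (sharp C T X Y f) = sharp C T (ob F X) (ob F Y) (ar F X Y f)"
    using F by (simp_all add: lifts_to_def)
  have S [simp]: "is_monad K ?S" and \<nu>: "is_nat_trans K Fbar ?S \<nu>"
    using assms(11) unfolding is_free_monad_over_def by auto
  have [simp]: "\<nu> X \<in> hom K (ob F X) (ob ?S X)" for X using nat_trans_hom[OF \<nu>, of X] by simp
  have h_hom [simp]: "h X \<in> hom K (sum_ob P (ob F X) X) (ob ?S X)" for X
    using cotuple_hom[OF Q, of "\<nu> X" "ob F X" "ob ?S X" "unit ?S X" X] by (simp add: h_def)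
  have [simp]: "is_monad K G" using assms(8) by (simp add: G_def Q_def)
  \<comment> \<open>Lifting only concerns the functor part, so the result for \<open>plus_id\<close>
    carries over to the monad \<open>G\<close>.\<close>
  have "ob G = ob (plus_id K Q Fbar)" "ar G = ar (plus_id K Q Fbar)"
    by (simp_all add: G_def tau_monad_def)
  then have liftG: "lifts_to C T (plus_id C P F) G"
    using plus_id_lifts[OF category monad P F] by (simp add: lifts_to_def Q_def)
  have obG [simp]: "ob G X = sum_ob P (ob F X) X" for X
    by (simp add: G_def tau_monad_def plus_id_def)
  have \<alpha> [simp]: "\<alpha> \<in> hom K X (sum_ob P (ob F X) X)"
    using assms(18) by (simp add: tau_monad_def plus_id_def)
  have underline: "underline K Q Fbar ?S \<nu> Y \<beta> = cmp K Y (sum_ob P (ob F Y) Y) (ob ?S Y) (h Y) \<beta>" for Y \<beta>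
    by (simp add: underline_def h_def)
  let ?u = "\<lambda>Y \<beta>. cmp K Y (sum_ob P (ob F Y) Y) (ob ?S Y) (h Y) \<beta>"

  \<comment> \<open>\<open>FA.M\<close> is the second free monad over \<open>Fbar\<close>; its
    algebra structure and unit are sharpened base arrows.\<close>
  interpret FA: free_algebras K Fbar A "\<lambda>X. sharp C T (ob F (A X)) (A X) (\<phi> X)" "\<lambda>X. sharp C T X (A X) (u X)"
    by unfold_locales (simp_all add: Kl_free_algebra[OF _ _ F assms(9)])
  obtain j k where j: "is_monad_morphism K FA.M ?S j" and k: "is_monad_morphism K ?S FA.M k"
    and j\<nu>: "\<And>X. cmp K (ob Fbar X) (ob FA.M X) (ob ?S X) (j X) (FA.embedding X) = \<nu> X"
    and kj: "\<And>X. cmp K (ob FA.M X) (ob ?S X) (ob FA.M X) (k X) (j X) = idm K (ob FA.M X)"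
    and jk: "\<And>X. cmp K (ob ?S X) (ob FA.M X) (ob ?S X) (j X) (k X) = idm K (ob ?S X)"
    using free_monad_unique[OF _ _ FA.free_algebra_monad_is_free assms(11)] by auto
  have [simp]: "j X \<in> hom K (A X) (ob ?S X)" "k X \<in> hom K (ob ?S X) (A X)" for X
    using j k nat_trans_hom[of K FA.M ?S j X] nat_trans_hom[of K ?S FA.M k X]
    unfolding is_monad_morphism_def by auto
  have ju: "cmp K X (A X) (ob ?S X) (j X) (sharp C T X (A X) (u X)) = unit ?S X" for X
    using j unfolding is_monad_morphism_def by simp
  have free: "\<phi> X \<in> hom C (ob F (A X)) (A X)" "u X \<in> hom C X (A X)" for X
    using assms(9)[of X] by (simp_all add: is_free_algebra_def)
  note [simp] = free
  \<comment> \<open>The counterpart of \<open>h\<close> for \<open>FA.M\<close>, formed in the base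
    category. Since \<open>j\<close> preserves units and the embedding, \<open>h X\<close> is
    \<open>j X\<close> after its sharpened version.\<close>
  define h0 where "h0 = cotuple C P (ob F X) X (A X)
    (cmp C (ob F X) (ob F (A X)) (A X) (\<phi> X) (ar F X (A X) (u X))) (u X)"
  have h0 [simp]: "h0 \<in> hom C (sum_ob P (ob F X) X) (A X)" by (simp add: h0_def)
  have "FA.embedding X = sharp C T (ob F X) (A X) (cmp C (ob F X) (ob F (A X)) (A X) (\<phi> X) (ar F X (A X) (u X)))"
    by (simp add: FA.embedding_def sharpF sharp_comp)
  then have "sharp C T (sum_ob P (ob F X) X) (A X) h0 =
      cotuple K Q (ob F X) X (A X) (FA.embedding X) (sharp C T X (A X) (u X))"
    by (simp add: h0_def sharp_cotuple Q_def)
  then have h_eq: "h X = cmp K (sum_ob P (ob F X) X) (A X) (ob ?S X) (j X)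
      (sharp C T (sum_ob P (ob F X) X) (A X) h0)"
    using comp_cotuple[OF category_K Q, of "FA.embedding X" "ob F X" "A X" "sharp C T X (A X) (u X)" X "j X" "ob ?S X"]
      FA.embedding_hom[of X] j\<nu>[of X] ju[of X]
    by (simp add: h_def)

  have "le (sum_ob P (ob F X) X) (ob ?S X)
    (cmp K (sum_ob P (ob F X) X) (sum_ob P (ob F X) X) (ob ?S X) (h X) (kl_ext K G X X \<alpha>))
    (cmp K (sum_ob P (ob F X) X) (ob ?S X) (ob ?S X) (kl_ext K ?S X X (?u X \<alpha>)) (h X))"
    using cotuple_kl_ext_le[of Q zero Fbar ?S \<nu> \<alpha> X "h X"] assms(6,14,16,17) \<nu>
    by (simp add: h_def G_def flip: Q_def)
  \<comment> \<open>The lax inequality survives saturation because \<open>h X\<close> is a base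
    arrow followed by the isomorphism \<open>j X\<close>.\<close>
  then have star_le: "le (sum_ob P (ob F X) X) (ob ?S X)
    (cmp K (sum_ob P (ob F X) X) (sum_ob P (ob F X) X) (ob ?S X) (h X) (star (sum_ob P (ob F X) X) (kl_ext K G X X \<alpha>)))
    (cmp K (sum_ob P (ob F X) X) (ob ?S X) (ob ?S X) (star (ob ?S X) (kl_ext K ?S X X (?u X \<alpha>))) (h X))"
    using kj[of X] jk[of X] kl_ext_hom[of K G \<alpha> X X] h_eq
    by (intro star_iso_sharp_le[where f = h0 and i = "j X" and j = "k X"]) simp_all
  have h_unit: "cmp K X (sum_ob P (ob F X) X) (ob ?S X) (h X) (unit G X) = unit ?S X" for X
    using cotuple_inj2[OF Q, of "\<nu> X" "ob F X" "ob ?S X" "unit ?S X" X]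
    by (simp add: h_def G_def tau_monad_def)
  have unitG [simp]: "unit G X \<in> hom K X (sum_ob P (ob F X) X)" for X
    using unit_hom[of K G X] by simp
  have extG [simp]: "kl_ext K G X X \<alpha> \<in> hom K (sum_ob P (ob F X) X) (sum_ob P (ob F X) X)"
    using kl_ext_hom[of K G \<alpha> X X] by simp
  let ?\<alpha>' = "saturate K star G X \<alpha>"
  have \<alpha>' [simp]: "?\<alpha>' \<in> hom K X (sum_ob P (ob F X) X)"
    using saturate_hom[of G \<alpha> X] by simp
  \<comment> \<open>Evaluate the saturated inequality at the unit of \<open>G\<close>, which
    \<open>h\<close> maps to the unit of the free monad.\<close>
  have u_le: "le X (ob ?S X) (?u X ?\<alpha>') (saturate K star ?S X (?u X \<alpha>))"
  proof -
    have "le X (ob ?S X)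
      (cmp K X (sum_ob P (ob F X) X) (ob ?S X) (cmp K (sum_ob P (ob F X) X) (sum_ob P (ob F X) X) (ob ?S X)
        (h X) (star (sum_ob P (ob F X) X) (kl_ext K G X X \<alpha>))) (unit G X))
      (cmp K X (sum_ob P (ob F X) X) (ob ?S X) (cmp K (sum_ob P (ob F X) X) (ob ?S X) (ob ?S X)
        (star (ob ?S X) (kl_ext K ?S X X (?u X \<alpha>))) (h X)) (unit G X))"
      by (intro comp_mono star_le) simp_all
    then show ?thesis by (simp add: comp_assoc h_unit saturate_def)
  qed
  \<comment> \<open>The arrow \<open>?u X ?\<alpha>'\<close> lies between
    \<open>?u X \<alpha>\<close> and the saturation of the latter, so the closure operator does not
    distinguish them.\<close>
  have sat_eq: "saturate K star ?S X (?u X \<alpha>) = saturate K star ?S X (?u X ?\<alpha>')"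
  proof (rule le_antisym)
    have 1: "le X (ob ?S X) (?u X \<alpha>) (?u X ?\<alpha>')"
      using le_saturate[of G \<alpha> X] by (intro comp_mono) simp_all
    have 2: "le X (ob ?S X) (?u X ?\<alpha>') (saturate K star ?S X (?u X ?\<alpha>'))"
      by (rule le_saturate) simp_all
    have "le X (ob ?S X) (?u X \<alpha>) (saturate K star ?S X (?u X ?\<alpha>'))"
      by (rule le_trans[OF 1 2]) simp_all
    then show "le X (ob ?S X) (saturate K star ?S X (?u X \<alpha>)) (saturate K star ?S X (?u X ?\<alpha>'))"
      by (intro saturate_le_saturate assms) simp_all
    show "le X (ob ?S X) (saturate K star ?S X (?u X ?\<alpha>')) (saturate K star ?S X (?u X \<alpha>))"
      by (intro saturate_le_saturate assms u_le) simp_all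
  qed simp_all

  \<comment> \<open>The coalgebra \<open>\<gamma>\<close> need not be saturated. Naturality of
    \<open>h\<close> makes \<open>f\<close> a homomorphism from \<open>?u X ?\<alpha>'\<close> to
    \<open>?u Z \<gamma>\<close>, and saturation preserves this; \<open>sat_eq\<close> then replaces
    the source by the desired one.\<close>
  have coalg_hom: "is_coalg_hom C (comp_functor T (free_algebra_monad C F A \<phi> u))
      X (saturate K star ?S X (?u X \<alpha>)) Z (saturate K star ?S Z (?u Z \<gamma>)) f"
    if hom: "is_coalg_hom C (comp_functor T (plus_id C P F)) X ?\<alpha>' Z \<gamma> f"
      and \<gamma> [simp]: "\<gamma> \<in> hom K Z (sum_ob P (ob F Z) Z)" for Z \<gamma> f
  proof -
    let ?f = "sharp C T X Z f"
    have f [simp]: "f \<in> hom C X Z" using hom by (simp add: is_coalg_hom_def)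
    have Gf: "ar G X Z ?f = sum_map K Q (ob F X) X (ob F Z) Z (ar Fbar X Z ?f) ?f"
      by (simp add: G_def tau_monad_def plus_id_def)
    have [simp]: "ar Fbar X Z ?f \<in> hom K (ob F X) (ob F Z)"
      using functor_hom[of K Fbar ?f X Z] by simp
    have Gf_hom [simp]: "ar G X Z ?f \<in> hom K (sum_ob P (ob F X) X) (sum_ob P (ob F Z) Z)"
      using functor_hom[of K G ?f X Z] by simp
    have eq: "cmp K X (sum_ob P (ob F X) X) (sum_ob P (ob F Z) Z) (ar G X Z ?f) ?\<alpha>' =
        cmp K X Z (sum_ob P (ob F Z) Z) \<gamma> ?f"
      using hom coalg_hom_iff[OF category monad liftG, of ?\<alpha>' X \<gamma> Z f] by simp
    have "cmp K (sum_ob P (ob F X) X) (sum_ob P (ob F Z) Z) (ob ?S Z) (h Z) (ar G X Z ?f) =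
        cmp K (sum_ob P (ob F X) X) (ob ?S X) (ob ?S Z) (ar ?S X Z ?f) (h X)"
      using cotuple_sum_map[OF category_K Q, of "ar Fbar X Z ?f" "ob F X" "ob F Z" ?f X Z "\<nu> Z" "ob ?S Z" "unit ?S Z"]
        comp_cotuple[OF category_K Q, of "\<nu> X" "ob F X" "ob ?S X" "unit ?S X" X "ar ?S X Z ?f" "ob ?S Z"]
        naturality[OF \<nu>, of ?f X Z]
      by (simp add: Gf h_def unit_natural)
    then have "cmp K X (ob ?S X) (ob ?S Z) (ar ?S X Z ?f) (?u X ?\<alpha>') =
        cmp K X (sum_ob P (ob F Z) Z) (ob ?S Z) (h Z)
          (cmp K X (sum_ob P (ob F X) X) (sum_ob P (ob F Z) Z) (ar G X Z ?f) ?\<alpha>')"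
      by (intro comp_reassoc) simp_all
    then have "cmp K X (ob ?S X) (ob ?S Z) (ar ?S X Z ?f) (?u X ?\<alpha>') = cmp K X Z (ob ?S Z) (?u Z \<gamma>) ?f"
      by (simp add: eq comp_assoc)
    then have "cmp K X (ob ?S X) (ob ?S Z) (ar ?S X Z ?f) (saturate K star ?S X (?u X ?\<alpha>')) =
        cmp K X Z (ob ?S Z) (saturate K star ?S Z (?u Z \<gamma>)) ?f"
      by (intro saturate_coalg_hom[OF S assms(10)]) simp_all
    then show ?thesis
      unfolding sat_eq by (subst coalg_hom_iff[OF category monad assms(10)]) simp_all
  qed
  obtain Z f g \<gamma> where jm: "jointly_monic C R X X p q" and \<gamma>: "\<gamma> \<in> hom C Z (ob T (sum_ob P (ob F Z) Z))"
    and f: "is_coalg_hom C (comp_functor T (plus_id C P F)) X ?\<alpha>' Z \<gamma> f"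
    and g: "is_coalg_hom C (comp_functor T (plus_id C P F)) X ?\<alpha>' Z \<gamma> g"
    and pb: "is_pullback C X X Z f g R p q"
    using assms(19) unfolding is_bisimulation_def
    by (auto simp: comp_functor_def plus_id_def G_def Q_def)
  have \<gamma>K [simp]: "\<gamma> \<in> hom K Z (sum_ob P (ob F Z) Z)" using \<gamma> by (simp add: hom_Kl)
  have obS: "ob ?S Z = A Z" using assms(10) by (simp add: lifts_to_def free_algebra_monad_def)
  \<comment> \<open>The cospan \<open>f\<close>, \<open>g\<close> and its pullback are kept; only
    the structure on \<open>Z\<close> changes, from \<open>\<gamma>\<close> to this
    saturation.\<close>
  have "saturate K star ?S Z (?u Z \<gamma>) \<in> hom K Z (ob ?S Z)" by simp
  then have "saturate K star ?S Z (?u Z \<gamma>) \<in> hom C Z (ob (comp_functor T (free_algebra_monad C F A \<phi> u)) Z)"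
    by (simp add: hom_Kl comp_functor_def free_algebra_monad_def obS)
  then show ?thesis
    unfolding is_bisimulation_def Q_def[symmetric] underline
    using jm pb coalg_hom[OF f \<gamma>K] coalg_hom[OF g \<gamma>K] by blast
qed

end
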